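(* Let $E:[0,T]\times\mathbb{R}^m\rightrightarrows\mathbb{R}^m$ be a set-valued map such that: (E1) $E(t,z)$ is nonempty, closed, convex for all $(t,z)$; (E2) $z\mapsto E(t,z)$ has closed graph for every $t$; (E3) $z\mapsto E(t,z)$ is lower semicontinuous for every $t$; (E4) $t\mapsto E(t,z)$ is measurable for every $z$; (ELC) for every $R>0$ there is an integrable $k_R:[0,T]\to[0,\infty)$ with $E(t,x)\subset E(t,y)+k_R(t)|x-y|(\bar B^{m-1}\times[-1,1])$ for all $t\in[0,T]$, $x,y\in\bar B_R$. Let $P:[0,T]\rightrightarrows\mathbb{R}^m$ (with nonempty closed values) be absolutely continuous, and assume there is a set $C\subset(0,T)$ of full measure such that $$\forall t\in C,\ \forall z\in P(t):\quad \{1\}\times E(t,z)\subset\overline{\mathrm{conv}}\big(T_{\mathrm{gph}\,P}(t,z)\big).$$ Then for all $t_0\in(0,T)$ and $z_0\in P(t_0)$, every absolutely continuous $z:[t_0,T]\to\mathbb{R}^m$ with $\dot z(t)\in E(t,z(t))$ a.e. and $z(t_0)=z_0$ satisfies $z(t)\in P(t)$ for all $t\in[t_0,T]$.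
   Context: $\bar B_R$: closed ball radius $R$ about $0$ in $\mathbb{R}^m$; $\bar B^{m-1}$ the closed unit ball in $\mathbb{R}^{m-1}$, $\mathbb{R}^m=\mathbb{R}^{m-1}\times\mathbb{R}$. A set-valued map $F:[0,T]\rightrightarrows\mathbb{R}^m$ is measurable if $\{t:F(t)\cap U\ne\emptyset\}$ is Lebesgue measurable for every open $U$; lower semicontinuous if $\{z:F(z)\cap U\ne\emptyset\}$ is open for each open $U$. $\mathrm{gph}\,P=\{(t,z):z\in P(t)\}$; contingent cone $T_K(w)=\{v:\liminf_{\tau\to0^+}d(w+\tau v,K)/\tau=0\}$; $\overline{\mathrm{conv}}$ closed convex hull. $P$ (nonempty closed values) is absolutely continuous if for every $\varepsilon>0$ and compact $K\subset\mathbb{R}^m$ there is $\delta>0$ such that for every finite family of pairwise disjoint intervals $(t_i,s_i)\subset[0,T]$ with $\sum(s_i-t_i)<\delta$ one has $\sum d_K(P(s_i),P(t_i))<\varepsilon$, where $d_K(U,V)=\inf\{\varepsilon\ge0: U\cap K\subset V+\varepsilon\bar B,\ V\cap K\subset U+\varepsilon\bar B\}$ with $\bar B$ the closed unit ball. *)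

theory Defs
  imports "HOL-Analysis.Analysis"
begin

text \<open>R^m is modelled as real^'n with a linearly ordered finite index type;
  the last coordinate is the greatest index, so R^m = R^(m-1) x R.\<close>

definition last_idx :: "'n::{finite,wellorder}" where
  "last_idx = Max UNIV"

definition cyl :: "(real^'n::{finite,wellorder}) set" where
  "cyl = {v. (\<Sum>i\<in>UNIV - {last_idx}. (v$i)^2) \<le> 1 \<and> \<bar>v$last_idx\<bar> \<le> 1}"

definition disj_intervals :: "real \<Rightarrow> real \<Rightarrow> nat \<Rightarrow> (nat \<Rightarrow> real) \<Rightarrow> (nat \<Rightarrow> real) \<Rightarrow> bool" where
  "disj_intervals a b n t s \<longleftrightarrow>
     (\<forall>i<n. a \<le> t i \<and> t i \<le> s i \<and> s i \<le> b) \<and>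
     (\<forall>i<n. \<forall>j<n. i \<noteq> j \<longrightarrow> {t i<..<s i} \<inter> {t j<..<s j} = {})"

definition abs_cont_on :: "real \<Rightarrow> real \<Rightarrow> (real \<Rightarrow> 'a::real_normed_vector) \<Rightarrow> bool" where
  "abs_cont_on a b f \<longleftrightarrow>
     (\<forall>e>0. \<exists>d>0. \<forall>n t s. disj_intervals a b n t s \<and> (\<Sum>i<n. s i - t i) < d
        \<longrightarrow> (\<Sum>i<n. norm (f (s i) - f (t i))) < e)"

definition dK :: "'a::real_normed_vector set \<Rightarrow> 'a set \<Rightarrow> 'a set \<Rightarrow> real" where
  "dK K U V = Inf {e. e \<ge> 0 \<and>
      U \<inter> K \<subseteq> {v + w |v w. v \<in> V \<and> norm w \<le> e} \<and>
      V \<inter> K \<subseteq> {u + w |u w. u \<in> U \<and> norm w \<le> e}}"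

definition abs_cont_setval :: "real \<Rightarrow> (real \<Rightarrow> 'a::real_normed_vector set) \<Rightarrow> bool" where
  "abs_cont_setval T P \<longleftrightarrow>
     (\<forall>e>0. \<forall>K. compact K \<longrightarrow> (\<exists>d>0. \<forall>n t s. disj_intervals 0 T n t s \<and> (\<Sum>i<n. s i - t i) < d
        \<longrightarrow> (\<Sum>i<n. dK K (P (s i)) (P (t i))) < e))"

definition measurable_setval :: "real \<Rightarrow> (real \<Rightarrow> 'a::topological_space set) \<Rightarrow> bool" where
  "measurable_setval T F \<longleftrightarrow>
     (\<forall>U. open U \<longrightarrow> {t \<in> {0..T}. F t \<inter> U \<noteq> {}} \<in> sets lebesgue)"

definition lsc_setval :: "('a::topological_space \<Rightarrow> 'b::topological_space set) \<Rightarrow> bool" where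
  "lsc_setval F \<longleftrightarrow> (\<forall>U. open U \<longrightarrow> open {z. F z \<inter> U \<noteq> {}})"

definition gph :: "real \<Rightarrow> (real \<Rightarrow> 'a set) \<Rightarrow> (real \<times> 'a) set" where
  "gph T P = {(t, z). t \<in> {0..T} \<and> z \<in> P t}"

definition contingent_cone :: "'a::real_normed_vector set \<Rightarrow> 'a \<Rightarrow> 'a set" where
  "contingent_cone K w =
     {v. Liminf (at_right 0) (\<lambda>\<tau>::real. ereal (infdist (w + \<tau> *\<^sub>R v) K / \<tau>)) = 0}"

end

theory Submission
  imports Defs
begin

text \<open>The function $g(t) = d(z(t), P(t))$ is absolutely continuous, hence differentiable almost
  everywhere. At a good time with $g(t) > 0$ let $y$ be a nearest point of $P(t)$ to $z(t)$. The
  function $(s, x) \mapsto |z(s) - x| - g(s)$ is nonnegative on the graph of $P$, vanishes at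
  $(t, y)$ and is differentiable there, so its derivative is nonnegative on the contingent cone and,
  being linear, on the closed convex hull of that cone. Evaluating it at $(1, a)$ with $a \in E(t, y)$
  close to $\dot z(t) \in E(t, z(t))$, which exists by the Lipschitz condition, gives
  $g'(t) \le |\dot z(t) - a| \le 2 k(t) g(t)$. Thus $\ln g$ has an integrable upper bound on its
  derivative wherever $g > 0$, so $g$ cannot leave the value $0$.\<close>

section \<open>Families of disjoint intervals\<close>

text \<open>Both the Lipschitz function and the truncated distance \<open>dK\<close> are tied to a
  ball, so one ball must be found beforehand that contains the trajectory and every nearest point of
  \<open>P t\<close> to \<open>z s\<close>, for all times \<open>s\<close> and \<open>t\<close>. The
  sets \<open>P t\<close> may be unbounded, but absolute continuity keeps their distance from the
  origin bounded, and this is enough. The nearest point is frozen at the time considered: the test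
  function is nonnegative on the whole graph, so no choice of nearest points depending on time is
  made. The factor 2 bounds the norm of the elements of \<open>cyl\<close>. The logarithm suits an
  estimate that holds only where the distance is positive: going back from such a time to the last
  zero before it, the logarithm falls by at most twice the integral of \<open>k\<close>, although it
  would have to tend to minus infinity. Passing from a derivative bound almost everywhere to a bound
  on increments takes two tools: differentiability almost everywhere, by Vitali coverings, and a
  gauge estimate in which absolute continuity absorbs the exceptional tags.\<close>

lemma abs_cont_on_family:
  fixes f :: "real \<Rightarrow> 'a::real_normed_vector"
  assumes "abs_cont_on a b f" "0 < e"
  obtains d where "0 < d"
    "\<And>(I::'i set) u v. \<lbrakk>finite I; \<And>i. i \<in> I \<Longrightarrow> a \<le> u i \<and> u i \<le> v i \<and> v i \<le> b;
       disjoint_family_on (\<lambda>i. {u i<..<v i}) I; (\<Sum>i\<in>I. v i - u i) < d\<rbrakk>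
      \<Longrightarrow> (\<Sum>i\<in>I. norm (f (v i) - f (u i))) < e"
proof -
  obtain d where "d > 0" and
    d: "\<forall>n t s. disj_intervals a b n t s \<and> (\<Sum>i<n. s i - t i) < d
          \<longrightarrow> (\<Sum>i<n. norm (f (s i) - f (t i))) < e"
    using assms(1)[unfolded abs_cont_on_def, rule_format, OF assms(2)] by (elim exE conjE) (rule that)
  show thesis
  proof (rule that[OF \<open>d > 0\<close>])
    fix I :: "'i set" and u v :: "'i \<Rightarrow> real"
    assume I: "finite I" "\<And>i. i \<in> I \<Longrightarrow> a \<le> u i \<and> u i \<le> v i \<and> v i \<le> b"
      and disj: "disjoint_family_on (\<lambda>i. {u i<..<v i}) I" and less: "(\<Sum>i\<in>I. v i - u i) < d"
    \<comment> \<open>The definition sums over initial segments of the naturals, while the families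
      met later are indexed by intervals, by pairs of intervals or by tagged cells. Enumerating
      \<open>I\<close> bridges the two.\<close>
    obtain h where h: "bij_betw h {..<card I} I"
      using I(1) by (metis ex_bij_betw_nat_finite atLeast0LessThan)
    have "disj_intervals a b (card I) (u \<circ> h) (v \<circ> h)"
      unfolding disj_intervals_def
    proof (intro conjI allI impI)
      fix i assume "i < card I"
      then have "h i \<in> I" using h by (auto simp: bij_betw_def)
      then show "a \<le> (u \<circ> h) i" "(u \<circ> h) i \<le> (v \<circ> h) i" "(v \<circ> h) i \<le> b"
        using I(2) by auto
      fix j assume "j < card I" "i \<noteq> j"
      then have "h j \<in> I" "h i \<noteq> h j"
        using h \<open>i < card I\<close> by (auto simp: bij_betw_def inj_on_def)
      then show "{(u \<circ> h) i<..<(v \<circ> h) i} \<inter> {(u \<circ> h) j<..<(v \<circ> h) j} = {}"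
        using disj \<open>h i \<in> I\<close> by (auto simp: disjoint_family_on_def)
    qed
    then show "(\<Sum>i\<in>I. norm (f (v i) - f (u i))) < e"
      using d[rule_format, of "card I" "u \<circ> h" "v \<circ> h"] less
        sum.reindex_bij_betw[OF h, of "\<lambda>i. v i - u i"]
        sum.reindex_bij_betw[OF h, of "\<lambda>i. norm (f (v i) - f (u i))"]
      by simp
  qed
qed

lemma abs_cont_on_uniform:
  fixes f :: "real \<Rightarrow> 'a::real_normed_vector"
  assumes "abs_cont_on a b f" "0 < e"
  obtains d where "0 < d" "\<And>s t. \<lbrakk>s \<in> {a..b}; t \<in> {a..b}; \<bar>s - t\<bar> < d\<rbrakk> \<Longrightarrow> norm (f s - f t) < e"
proof (rule abs_cont_on_family[OF assms, where 'i = nat])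
  fix d assume "d > 0" and
    d: "\<And>(I::nat set) u v. \<lbrakk>finite I; \<And>i. i \<in> I \<Longrightarrow> a \<le> u i \<and> u i \<le> v i \<and> v i \<le> b;
       disjoint_family_on (\<lambda>i. {u i<..<v i}) I; (\<Sum>i\<in>I. v i - u i) < d\<rbrakk>
      \<Longrightarrow> (\<Sum>i\<in>I. norm (f (v i) - f (u i))) < e"
  have "norm (f s - f t) < e" if "s \<in> {a..b}" "t \<in> {a..b}" "\<bar>s - t\<bar> < d" for s t
    using d[of "{0}" "\<lambda>_. min s t" "\<lambda>_. max s t"] that
    by (cases "s \<le> t") (auto simp: disjoint_family_on_def norm_minus_commute)
  with \<open>d > 0\<close> show thesis by (rule that)
qed

lemma abs_cont_on_imp_continuous_on: "abs_cont_on a b f \<Longrightarrow> continuous_on {a..b} f"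
  unfolding continuous_on_iff by (metis abs_cont_on_uniform dist_norm dist_real_def)

lemma measure_disjoint_intervals:
  assumes "finite C" "\<And>u v. (u, v) \<in> C \<Longrightarrow> u \<le> v"
    and "disjoint_family_on (\<lambda>(u, v). {u..v}) C"
  shows "measure lebesgue (\<Union>(u, v)\<in>C. {u..v}) = (\<Sum>(u, v)\<in>C. v - u :: real)"
proof -
  have "measure lebesgue (\<Union>(u, v)\<in>C. {u..v}) = (\<Sum>p\<in>C. measure lebesgue (case p of (u, v) \<Rightarrow> {u..v}))"
    using assms
    by (intro measure_UNION') (auto simp: pairwise_def disjnt_def disjoint_family_on_def)
  also have "\<dots> = (\<Sum>(u, v)\<in>C. v - u)"
    using assms(2) by (intro sum.cong) auto
  finally show ?thesis .
qed

text \<open>Vitali's theorem gives a countable disjoint subfamily that misses only a null set. All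
  its members lie in \<open>{a..b}\<close>, so their union has finite measure and a finite subfamily
  leaves less than \<open>e\<close> uncovered. The set \<open>S\<close> may fail to be measurable,
  so what is left over is enclosed in a measurable \<open>T\<close>.\<close>

lemma Vitali_covering_intervals:
  fixes S :: "real set"
  assumes cover: "\<And>x d. \<lbrakk>x \<in> S; 0 < d\<rbrakk> \<Longrightarrow> \<exists>u v. (u, v) \<in> K \<and> x \<in> {u..v} \<and> v - u < d"
    and K: "\<And>u v. (u, v) \<in> K \<Longrightarrow> a \<le> u \<and> u < v \<and> v \<le> b"
    and e: "0 < e"
  obtains C T where "finite C" "C \<subseteq> K" "disjoint_family_on (\<lambda>(u, v). {u..v}) C"
    "T \<in> lmeasurable" "measure lebesgue T < e" "S \<subseteq> (\<Union>(u, v)\<in>C. {u..v}) \<union> T"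
proof -
  \<comment> \<open>Midpoint and half-length turn intervals into closed balls, the form in which the
    covering theorem is stated.\<close>
  define m r where "m = (\<lambda>p::real\<times>real. (fst p + snd p) / 2)" and "r = (\<lambda>p::real\<times>real. (snd p - fst p) / 2)"
  have cb: "cball (m p) (r p) = (case p of (u, v) \<Rightarrow> {u..v})" for p
    by (auto simp: m_def r_def cball_def dist_real_def abs_le_iff field_simps split: prod.splits)
  obtain C where C: "countable C" "C \<subseteq> K"
    "pairwise (\<lambda>i j. disjnt (cball (m i) (r i)) (cball (m j) (r j))) C"
    "negligible (S - (\<Union>i\<in>C. cball (m i) (r i)))"
  proof (rule Vitali_covering_theorem_cballs)
    show "0 < r i" if "i \<in> K" for i
      using K[of "fst i" "snd i"] that by (auto simp: r_def)
    show "\<exists>i. i \<in> K \<and> x \<in> cball (m i) (r i) \<and> r i < d" if x: "x \<in> S" "0 < d" for x d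
    proof -
      obtain u v where "(u, v) \<in> K" "x \<in> {u..v}" "v - u < d" using cover[OF x] by blast
      then have "(u, v) \<in> K \<and> x \<in> cball (m (u, v)) (r (u, v)) \<and> r (u, v) < d"
        using K[of u v] by (simp add: cb) (simp add: r_def)
      then show ?thesis by blast
    qed
  qed
  define J where "J = (\<lambda>p. cball (m p) (r p))"
  have JL: "J p \<in> lmeasurable" for p by (simp add: J_def)
  have Jab: "J p \<subseteq> {a..b}" if "p \<in> K" for p
    using K[of "fst p" "snd p"] that by (auto simp: J_def cb split: prod.splits)
  have bd: "measure lebesgue (\<Union>D') \<le> measure lebesgue {a..b}" if "D' \<subseteq> J ` C" "finite D'" for D'
  proof (rule measure_mono_fmeasurable)
    show "\<Union>D' \<subseteq> {a..b}" using that(1) Jab C(2) by blast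
    show "\<Union>D' \<in> sets lebesgue"
      using that JL by (intro sets.finite_Union) (auto simp: fmeasurableD)
  qed simp
  have big: "\<Union>(J ` C) \<in> lmeasurable"
    using C(1) bd JL by (intro fmeasurable_Union_bound[where B="measure lebesgue {a..b}"]) auto
  obtain D' where D': "D' \<subseteq> J ` C" "finite D'"
      "measure lebesgue (\<Union>(J ` C)) - e < measure lebesgue (\<Union>D')"
  proof (rule measure_countable_Union_approachable)
    show "countable (J ` C)" using C(1) by simp
    show "d \<in> lmeasurable" if "d \<in> J ` C" for d using that JL by auto
  qed (use e bd in auto)
  obtain F where F: "F \<subseteq> C" "finite F" "D' = J ` F"
    using D' by (meson finite_subset_image)
  let ?T = "(\<Union>(J ` C) - \<Union>(J ` F)) \<union> (S - (\<Union>i\<in>C. J i))"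
  have negl: "negligible (S - (\<Union>i\<in>C. J i))" using C(4) by (simp add: J_def)
  have FL: "\<Union>(J ` F) \<in> lmeasurable" using F JL by (intro fmeasurable.finite_Union) auto
  show thesis
  proof
    show "finite F" "F \<subseteq> K" using F C by auto
    show "disjoint_family_on (\<lambda>(u, v). {u..v}) F"
      using C(3) F(1) unfolding disjoint_family_on_def pairwise_def disjnt_def cb by blast
    show "?T \<in> lmeasurable"
      using fmeasurable.Un[OF fmeasurable.Diff[OF big FL] negligible_imp_measurable[OF negl]] .
    have "measure lebesgue ?T \<le> measure lebesgue (\<Union>(J ` C) - \<Union>(J ` F)) + measure lebesgue (S - (\<Union>i\<in>C. J i))"
      using big FL negl by (intro measure_Un_le) (auto intro: fmeasurableD negligible_imp_sets)
    also have "\<dots> = measure lebesgue (\<Union>(J ` C)) - measure lebesgue (\<Union>(J ` F))"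
      using big FL F(1) negl by (subst measurable_measure_Diff) (auto simp: negligible_imp_measure0 intro: fmeasurableD)
    also have "\<dots> < e" using D' F by simp
    finally show "measure lebesgue ?T < e" .
    show "S \<subseteq> (\<Union>(u, v)\<in>F. {u..v}) \<union> ?T"
      using F by (auto simp: J_def cb split: prod.splits)
  qed
qed

text \<open>Induction removes the rightmost interval. The identity is claimed for all
  \<open>f\<close> with the same \<open>G\<close>, since it is used both for the identity function
  (total length of the gaps) and for the function under study (total increment over them). Gaps may
  degenerate to points, when intervals reach an end of \<open>{c..d}\<close>.\<close>

lemma interval_gaps:
  fixes c d :: real
  assumes "finite C" "\<And>u v. (u, v) \<in> C \<Longrightarrow> c \<le> u \<and> u < v \<and> v \<le> d"
    and "disjoint_family_on (\<lambda>(u, v). {u..v}) C" "c \<le> d"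
  shows "\<exists>G. finite G \<and> (\<forall>(u, v)\<in>G. c \<le> u \<and> u \<le> v \<and> v \<le> d) \<and>
           disjoint_family_on (\<lambda>(u, v). {u<..<v}) G \<and>
           (\<forall>f::real \<Rightarrow> real. (\<Sum>(u, v)\<in>G. f v - f u) = f d - f c - (\<Sum>(u, v)\<in>C. f v - f u))"
  using assms
proof (induction "card C" arbitrary: C d)
  case 0
  then have "C = {}" by simp
  then show ?case
    using 0 by (intro exI[of _ "{(c, d)}"]) (auto simp: disjoint_family_on_def)
next
  case (Suc n)
  then have "C \<noteq> {}" by auto
  then obtain p where p: "p \<in> C" "\<And>q. q \<in> C \<Longrightarrow> snd q \<le> snd p"
    using obtains_MAX[OF Suc.prems(1), of snd] Suc.prems(1) by (metis Max_ge finite_imageI imageI)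
  obtain u v where uv: "p = (u, v)" by fastforce
  have bnd: "c \<le> u" "u < v" "v \<le> d" using Suc.prems(2) p uv by auto
  let ?C = "C - {p}"
  \<comment> \<open>The interval \<open>p\<close> has the largest right endpoint, so one that is
    disjoint from it and does not end before \<open>u\<close> would have to end beyond
    \<open>v\<close>.\<close>
  have left: "y < u" if "(x, y) \<in> ?C" for x y
  proof -
    have "y \<le> v" "x < y" using p(2)[of "(x, y)"] that uv Suc.prems(2) by auto
    moreover have "{x..y} \<inter> {u..v} = {}"
      using Suc.prems(3) that p(1) uv unfolding disjoint_family_on_def by fastforce
    ultimately show ?thesis using bnd by (cases "y < u") (auto simp: disjoint_iff)
  qed
  have "\<exists>G. finite G \<and> (\<forall>(x, y)\<in>G. c \<le> x \<and> x \<le> y \<and> y \<le> u) \<and>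
           disjoint_family_on (\<lambda>(u, v). {u<..<v}) G \<and>
           (\<forall>f::real \<Rightarrow> real. (\<Sum>(u, v)\<in>G. f v - f u) = f u - f c - (\<Sum>(u, v)\<in>?C. f v - f u))"
  proof (rule Suc.hyps(1))
    show "n = card ?C" using Suc.hyps(2) p(1) Suc.prems(1) by simp
    show "disjoint_family_on (\<lambda>(u, v). {u..v}) ?C"
      using Suc.prems(3) by (rule disjoint_family_on_mono[rotated]) auto
    show "c \<le> x \<and> x < y \<and> y \<le> u" if "(x, y) \<in> ?C" for x y
      using left[OF that] Suc.prems(2)[of x y] that by auto
  qed (use Suc.prems bnd in auto)
  then obtain G where G: "finite G" "\<forall>(x, y)\<in>G. c \<le> x \<and> x \<le> y \<and> y \<le> u"
    "disjoint_family_on (\<lambda>(u, v). {u<..<v}) G"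
    "\<forall>f::real \<Rightarrow> real. (\<Sum>(u, v)\<in>G. f v - f u) = f u - f c - (\<Sum>(u, v)\<in>?C. f v - f u)"
    by (elim exE conjE) (rule that)
  have notin: "(v, d) \<notin> G" using G(2) bnd by auto
  show ?case
  proof (intro exI conjI allI)
    show "finite (insert (v, d) G)" using G(1) by simp
    show "\<forall>(x, y)\<in>insert (v, d) G. c \<le> x \<and> x \<le> y \<and> y \<le> d"
      using G(2) bnd by fastforce
    have "{v<..<d} \<inter> (\<Union>(x, y)\<in>G. {x<..<y}) = {}"
      using G(2) bnd by fastforce
    then show "disjoint_family_on (\<lambda>(u, v). {u<..<v}) (insert (v, d) G)"
      using G(3) notin by (subst disjoint_family_on_insert) auto
    show "(\<Sum>(u, v)\<in>insert (v, d) G. f v - f u) = f d - f c - (\<Sum>(u, v)\<in>C. f v - f u)" for f :: "real \<Rightarrow> real"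
      using G(1) G(4)[rule_format, of f] notin Suc.prems(1) p(1) uv by (simp add: sum.remove[of C p])
  qed
qed

section \<open>Almost everywhere differentiability of absolutely continuous functions\<close>

lemma lmeasurable_outer_open:
  fixes S :: "'a::euclidean_space set"
  assumes S: "S \<in> lmeasurable" and "0 < e"
  obtains U where "open U" "S \<subseteq> U" "U \<in> lmeasurable" "measure lebesgue U < measure lebesgue S + e"
proof -
  obtain U where U: "open U" "S \<subseteq> U" "U - S \<in> lmeasurable" "emeasure lebesgue (U - S) < ennreal e"
    using sets_lebesgue_outer_open[OF fmeasurableD[OF S] \<open>0 < e\<close>] by blast
  have eq: "U = S \<union> (U - S)" using U(2) by blast
  have "measure lebesgue (U - S) < e"
    using U(3,4) \<open>0 < e\<close> by (simp add: emeasure_eq_measure2 ennreal_less_iff)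
  moreover have "measure lebesgue U \<le> measure lebesgue S + measure lebesgue (U - S)"
    using measure_Un_le[of S lebesgue "U - S"] S U(3) eq by (simp add: fmeasurableD)
  moreover have "U \<in> lmeasurable"
    using fmeasurable.Un[OF S U(3)] eq by simp
  ultimately show thesis using U(1,2) by (intro that) auto
qed

text \<open>The intervals need only contain \<open>x\<close>, which is the local smallness required
  of a Vitali cover. With \<open>Q\<close> of the form \<open>s < p\<close> or \<open>q < s\<close>
  this tests the lower or upper derivate at \<open>x\<close>; its failure bounds the difference
  quotients on both sides.\<close>

definition frequent_slope :: "real \<Rightarrow> real \<Rightarrow> (real \<Rightarrow> real) \<Rightarrow> (real \<Rightarrow> bool) \<Rightarrow> real \<Rightarrow> bool" where
  "frequent_slope a b f Q x \<longleftrightarrow>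
     (\<forall>d>0. \<exists>u v. a \<le> u \<and> v \<le> b \<and> u < v \<and> u \<le> x \<and> x \<le> v \<and> v - u < d \<and> Q ((f v - f u) / (v - u)))"

lemma frequent_slopeE:
  assumes "frequent_slope a b f Q x" "0 < d"
  obtains u v where "a \<le> u" "v \<le> b" "u < v" "u \<le> x" "x \<le> v" "v - u < d" "Q ((f v - f u) / (v - u))"
  using assms unfolding frequent_slope_def by blast

text \<open>Two Vitali covers: intervals of slope below $p$ nearly exhaust the set, and inside them
  intervals of slope above $q$ nearly exhaust it again. The gaps between the two families have
  small total length, so by absolute continuity the two total increments nearly agree.
  The set need not be known to be measurable, so $m$ below is its outer measure.\<close>
lemma negligible_two_slopes:
  fixes f :: "real \<Rightarrow> real"
  assumes ac: "abs_cont_on a b f" and pq: "p < q"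
  shows "negligible {x \<in> {a..b}. frequent_slope a b f (\<lambda>s. s < p) x \<and> frequent_slope a b f (\<lambda>s. q < s) x}"
    (is "negligible ?S")
proof -
  define \<T> where "\<T> = {T. T \<in> lmeasurable \<and> ?S \<subseteq> T}"
  define m where "m = Inf (measure lebesgue ` \<T>)"
  have ab: "{a..b} \<in> \<T>" unfolding \<T>_def by auto
  have bdd: "bdd_below (measure lebesgue ` \<T>)" by (rule bdd_belowI[of _ 0]) auto
  have m_le: "m \<le> measure lebesgue T" if "T \<in> lmeasurable" "?S \<subseteq> T" for T
    unfolding m_def using that bdd by (intro cInf_lower) (auto simp: \<T>_def)
  have m_approx: "\<exists>T\<in>\<T>. measure lebesgue T < m + e" if "e > 0" for e
    using that ab cInf_lessD[of "measure lebesgue ` \<T>" "m + e"] by (auto simp: m_def)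
  have "\<not> m > 0"
  proof
    assume "m > 0"
    \<comment> \<open>\<open>c\<close> collects the errors of the closing estimate:
      \<open>L1 - L2\<close> is below \<open>4 * \<epsilon>\<close> and enters with factor
      \<open>p\<close>, while \<open>m\<close> exceeds \<open>L2\<close> by at most
      \<open>2 * \<epsilon>\<close>, which enters with factor \<open>q - p\<close>. Once
      \<open>c * \<epsilon> \<le> \<eta>\<close>, the estimate says that \<open>(q - p) * m\<close>
      is below \<open>2 * \<eta>\<close>, which is half of it.\<close>
    define c where "c = 4 * \<bar>p\<bar> + 2 * (q - p)"
    define \<eta> where "\<eta> = (q - p) * m / 4"
    have "c > 0" using pq unfolding c_def by (intro add_nonneg_pos) auto
    have "\<eta> > 0" using pq \<open>m > 0\<close> by (simp add: \<eta>_def)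
    show False
    proof (rule abs_cont_on_family[OF ac \<open>\<eta> > 0\<close>, where 'i = "(real \<times> real) \<times> (real \<times> real)"])
      fix \<delta> :: real
      assume "\<delta> > 0" and \<delta>: "\<And>(I::((real \<times> real) \<times> (real \<times> real)) set) u v.
        \<lbrakk>finite I; \<And>i. i \<in> I \<Longrightarrow> a \<le> u i \<and> u i \<le> v i \<and> v i \<le> b;
         disjoint_family_on (\<lambda>i. {u i<..<v i}) I; (\<Sum>i\<in>I. v i - u i) < \<delta>\<rbrakk>
        \<Longrightarrow> (\<Sum>i\<in>I. norm (f (v i) - f (u i))) < \<eta>"
      \<comment> \<open>The first entry makes the total gap length, which stays below
        \<open>4 * \<epsilon>\<close>, smaller than \<open>\<delta>\<close>.\<close>
      define \<epsilon> where "\<epsilon> = min (\<delta> / 5) (\<eta> / c)"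
      have \<epsilon>: "\<epsilon> > 0" "5 * \<epsilon> \<le> \<delta>" "c * \<epsilon> \<le> \<eta>"
        using \<open>\<delta> > 0\<close> \<open>\<eta> > 0\<close> \<open>c > 0\<close> by (auto simp: \<epsilon>_def min_def field_simps)
      obtain T0 where T0: "T0 \<in> lmeasurable" "?S \<subseteq> T0" "measure lebesgue T0 < m + \<epsilon>"
        using m_approx[OF \<epsilon>(1)] by (auto simp: \<T>_def)
      obtain U where U: "open U" "T0 \<subseteq> U" "U \<in> lmeasurable" "measure lebesgue U < measure lebesgue T0 + \<epsilon>"
        by (rule lmeasurable_outer_open[OF T0(1) \<epsilon>(1)])
      \<comment> \<open>Confinement to \<open>U\<close> is what bounds the total length of the first
        family by nearly the outer measure \<open>m\<close>.\<close>
      define K1 where "K1 = {(u, v). a \<le> u \<and> v \<le> b \<and> u < v \<and> {u..v} \<subseteq> U \<and> (f v - f u) / (v - u) < p}"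
      obtain F1 T1 where F1: "finite F1" "F1 \<subseteq> K1" "disjoint_family_on (\<lambda>(u, v). {u..v}) F1"
        and T1: "T1 \<in> lmeasurable" "measure lebesgue T1 < \<epsilon>" "?S \<subseteq> (\<Union>(u, v)\<in>F1. {u..v}) \<union> T1"
      proof (rule Vitali_covering_intervals[where K = K1 and S = ?S and a = a and b = b and e = \<epsilon>])
        fix x d :: real assume x: "x \<in> ?S" "0 < d"
        then have "x \<in> U" using T0 U by blast
        then obtain r where r: "r > 0" "ball x r \<subseteq> U" using U(1) openE by blast
        obtain u v where uv: "a \<le> u" "v \<le> b" "u < v" "u \<le> x" "x \<le> v" "v - u < min d r"
          "(f v - f u) / (v - u) < p"
          using x r(1) by (auto elim!: frequent_slopeE[of a b f "\<lambda>s. s < p" x "min d r"])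
        have "{u..v} \<subseteq> ball x r" using uv by (auto simp: dist_real_def)
        then show "\<exists>u v. (u, v) \<in> K1 \<and> x \<in> {u..v} \<and> v - u < d"
          using uv r by (intro exI[of _ u] exI[of _ v]) (auto simp: K1_def)
      qed (use \<epsilon> in \<open>auto simp: K1_def\<close>)
      define K2 where "K2 = {(u, v). u < v \<and> q < (f v - f u) / (v - u) \<and> (\<exists>(c, d)\<in>F1. c \<le> u \<and> v \<le> d)}"
      have F1D: "a \<le> c \<and> c < d \<and> d \<le> b \<and> {c..d} \<subseteq> U \<and> f d - f c \<le> p * (d - c)" if "(c, d) \<in> F1" for c d
        using that F1(2) by (auto simp: K1_def field_simps)
      \<comment> \<open>Only points interior to a cell have all short intervals around them inside
        that cell. The endpoints given up form the finite set \<open>?N\<close> below.\<close>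
      let ?S1 = "?S \<inter> (\<Union>(c, d)\<in>F1. {c<..<d})"
      obtain F2 T2 where F2: "finite F2" "F2 \<subseteq> K2" "disjoint_family_on (\<lambda>(u, v). {u..v}) F2"
        and T2: "T2 \<in> lmeasurable" "measure lebesgue T2 < \<epsilon>" "?S1 \<subseteq> (\<Union>(u, v)\<in>F2. {u..v}) \<union> T2"
      proof (rule Vitali_covering_intervals[where K = K2 and S = ?S1 and a = a and b = b and e = \<epsilon>])
        fix x e :: real assume x: "x \<in> ?S1" "0 < e"
        then obtain c d where cd: "(c, d) \<in> F1" "c < x" "x < d" by auto
        obtain u v where uv: "a \<le> u" "v \<le> b" "u < v" "u \<le> x" "x \<le> v" "v - u < min e (min (x - c) (d - x))"
          "q < (f v - f u) / (v - u)"
          using x cd by (auto elim!: frequent_slopeE[of a b f "\<lambda>s. q < s" x "min e (min (x - c) (d - x))"])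
        have "c \<le> u" "v \<le> d" using uv by auto
        then have "(u, v) \<in> K2" using uv cd(1) unfolding K2_def by blast
        then show "\<exists>u v. (u, v) \<in> K2 \<and> x \<in> {u..v} \<and> v - u < e"
          using uv by (intro exI[of _ u] exI[of _ v]) auto
      next
        show "a \<le> u \<and> u < v \<and> v \<le> b" if "(u, v) \<in> K2" for u v
          using that F1D by (fastforce simp: K2_def)
      qed (use \<epsilon> in auto)
      define C where "C = (\<lambda>(c, d). {p \<in> F2. c \<le> fst p \<and> snd p \<le> d})"
      have F2D: "u < v \<and> q * (v - u) \<le> f v - f u" if "(u, v) \<in> F2" for u v
        using that F2(2) by (auto simp: K2_def field_simps)
      have F2_eq: "F2 = (\<Union>i\<in>F1. C i)"
        using F2(2) by (fastforce simp: C_def K2_def)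
      have C_disj: "C i \<inter> C j = {}" if "i \<in> F1" "j \<in> F1" "i \<noteq> j" for i j
      proof -
        obtain c d c' d' where ij: "i = (c, d)" "j = (c', d')" by fastforce
        have "{c..d} \<inter> {c'..d'} = {}" using F1(3) that ij by (fastforce simp: disjoint_family_on_def)
        then show ?thesis using F2D unfolding ij C_def by (fastforce simp: disjoint_iff)
      qed
      have sum_F2: "(\<Sum>i\<in>F1. \<Sum>p\<in>C i. h p) = (\<Sum>p\<in>F2. h p)" for h :: "real \<times> real \<Rightarrow> real"
        unfolding F2_eq using F1(1) F2(1) C_disj
        by (intro sum.UNION_disjoint[symmetric]) (auto simp: C_def split: prod.splits)
      have "\<forall>i\<in>F1. \<exists>G. finite G \<and> (\<forall>(u, v)\<in>G. fst i \<le> u \<and> u \<le> v \<and> v \<le> snd i) \<and>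
           disjoint_family_on (\<lambda>(u, v). {u<..<v}) G \<and>
           (\<forall>f::real \<Rightarrow> real. (\<Sum>(u, v)\<in>G. f v - f u) = f (snd i) - f (fst i) - (\<Sum>(u, v)\<in>C i. f v - f u))"
      proof (intro ballI interval_gaps)
        fix i assume i: "i \<in> F1"
        have sub: "C i \<subseteq> F2" by (auto simp: C_def case_prod_beta)
        show "finite (C i)" using sub F2(1) by (rule finite_subset)
        show "disjoint_family_on (\<lambda>(u, v). {u..v}) (C i)"
          by (rule disjoint_family_on_mono[OF sub F2(3)])
        show "fst i \<le> u \<and> u < v \<and> v \<le> snd i" if "(u, v) \<in> C i" for u v
          using that F2D[of u v] by (auto simp: C_def case_prod_beta)
        show "fst i \<le> snd i" using F1D[of "fst i" "snd i"] i by auto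
      qed
      then obtain G where G: "\<forall>i\<in>F1. finite (G i) \<and> (\<forall>(u, v)\<in>G i. fst i \<le> u \<and> u \<le> v \<and> v \<le> snd i) \<and>
           disjoint_family_on (\<lambda>(u, v). {u<..<v}) (G i) \<and>
           (\<forall>f::real \<Rightarrow> real. (\<Sum>(u, v)\<in>G i. f v - f u) = f (snd i) - f (fst i) - (\<Sum>(u, v)\<in>C i. f v - f u))"
        by (rule bchoice[THEN exE])
      have G_fin: "finite (G i)" and G_disj: "disjoint_family_on (\<lambda>(u, v). {u<..<v}) (G i)"
        and G_sum: "(\<Sum>(u, v)\<in>G i. f v - f u) = f (snd i) - f (fst i) - (\<Sum>(u, v)\<in>C i. f v - f u)"
        if "i \<in> F1" for i and f :: "real \<Rightarrow> real"
        using bspec[OF G that] by blast+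
      have G_sub: "fst i \<le> u \<and> u \<le> v \<and> v \<le> snd i" if "i \<in> F1" "(u, v) \<in> G i" for i u v
        using bspec[OF G that(1)] that(2) by blast
      define I where "I = Sigma F1 G"
      have sum_I: "(\<Sum>i\<in>I. h (snd (snd i)) - h (fst (snd i)))
          = (\<Sum>(c, d)\<in>F1. h d - h c) - (\<Sum>(u, v)\<in>F2. h v - h u)" for h :: "real \<Rightarrow> real"
      proof -
        have "(\<Sum>i\<in>I. h (snd (snd i)) - h (fst (snd i))) = (\<Sum>i\<in>F1. \<Sum>(u, v)\<in>G i. h v - h u)"
          unfolding I_def using F1(1) G_fin by (subst sum.Sigma) (auto simp: case_prod_beta)
        also have "\<dots> = (\<Sum>i\<in>F1. h (snd i) - h (fst i) - (\<Sum>(u, v)\<in>C i. h v - h u))"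
          by (intro sum.cong refl G_sum)
        also have "\<dots> = (\<Sum>(c, d)\<in>F1. h d - h c) - (\<Sum>(u, v)\<in>F2. h v - h u)"
          by (simp add: sum_subtractf sum_F2 case_prod_beta)
        finally show ?thesis .
      qed
      define L1 L2 where "L1 = (\<Sum>(c, d)\<in>F1. d - c)" and "L2 = (\<Sum>(u, v)\<in>F2. v - u)"
      have "L1 = measure lebesgue (\<Union>(u, v)\<in>F1. {u..v})"
        unfolding L1_def using F1 F1D by (intro measure_disjoint_intervals[symmetric]) (auto intro: less_imp_le)
      also have "\<dots> \<le> measure lebesgue U"
        using F1D F1(1) U(3) by (intro measure_mono_fmeasurable) (auto intro!: sets.finite_UN)
      finally have L1: "L1 < m + 2 * \<epsilon>" using U(4) T0(3) by simp
      have L2: "L2 = measure lebesgue (\<Union>(u, v)\<in>F2. {u..v})"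
        unfolding L2_def using F2 F2D by (intro measure_disjoint_intervals[symmetric]) (auto intro: less_imp_le)
      let ?N = "fst ` F1 \<union> snd ` F1" and ?A = "\<Union>(u, v)\<in>F2. {u..v}"
      have A: "?A \<in> lmeasurable" using F2(1) by (intro fmeasurable.finite_UN) auto
      have N: "negligible ?N" using F1(1) by (intro negligible_finite) auto
      \<comment> \<open>This measurable cover of \<open>?S\<close> bounds the outer measure from
        above, hence the total length \<open>L2\<close> from below.\<close>
      have "?S \<subseteq> ?A \<union> (T1 \<union> (T2 \<union> ?N))"
      proof
        fix x assume x: "x \<in> ?S"
        show "x \<in> ?A \<union> (T1 \<union> (T2 \<union> ?N))"
        proof (cases "x \<in> T1 \<union> ?N")
          case False
          then obtain c d where "(c, d) \<in> F1" "x \<in> {c..d}" using T1(3) x by blast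
          moreover then have "x \<noteq> c" "x \<noteq> d" using False by force+
          ultimately have "x \<in> ?S1" using x by fastforce
          then show ?thesis using T2(3) by blast
        qed auto
      qed
      then have "m \<le> measure lebesgue (?A \<union> (T1 \<union> (T2 \<union> ?N)))"
        by (intro m_le fmeasurable.Un[OF A fmeasurable.Un[OF T1(1) fmeasurable.Un[OF T2(1) negligible_imp_measurable[OF N]]]])
      also have "\<dots> \<le> measure lebesgue ?A + measure lebesgue (T1 \<union> (T2 \<union> ?N))"
        using A T1(1) T2(1) negligible_imp_sets[OF N] by (intro measure_Un_le) (auto simp: fmeasurableD)
      also have "measure lebesgue (T1 \<union> (T2 \<union> ?N)) \<le> measure lebesgue T1 + measure lebesgue (T2 \<union> ?N)"
        using T1(1) T2(1) negligible_imp_sets[OF N] by (intro measure_Un_le) (auto simp: fmeasurableD)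
      also have "measure lebesgue (T2 \<union> ?N) \<le> measure lebesgue T2 + measure lebesgue ?N"
        using T2(1) negligible_imp_sets[OF N] by (intro measure_Un_le) (auto simp: fmeasurableD)
      also have "measure lebesgue ?N = 0" by (rule negligible_imp_measure0[OF N])
      finally have mL2: "m \<le> L2 + 2 * \<epsilon>" using T1(2) T2(2) L2 by simp
      have small: "(\<Sum>i\<in>I. norm (f (snd (snd i)) - f (fst (snd i)))) < \<eta>"
      proof (rule \<delta>)
        show "finite I" unfolding I_def using F1(1) G_fin by auto
        show "a \<le> fst (snd i) \<and> fst (snd i) \<le> snd (snd i) \<and> snd (snd i) \<le> b" if "i \<in> I" for i
          using that G_sub[of "fst i" "fst (snd i)" "snd (snd i)"] F1D[of "fst (fst i)" "snd (fst i)"]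
          by (auto simp: I_def)
        show "disjoint_family_on (\<lambda>i. {fst (snd i)<..<snd (snd i)}) I"
          unfolding disjoint_family_on_def
        proof (intro ballI impI)
          fix i j assume ij: "i \<in> I" "j \<in> I" "i \<noteq> j"
          obtain i1 u v j1 u' v' where eq: "i = (i1, (u, v))" "j = (j1, (u', v'))"
            by (metis surj_pair)
          have mem: "i1 \<in> F1" "j1 \<in> F1" "(u, v) \<in> G i1" "(u', v') \<in> G j1"
            using ij eq by (auto simp: I_def)
          have "{u<..<v} \<inter> {u'<..<v'} = {}"
          proof (cases "i1 = j1")
            case True
            then have "disjoint_family_on (\<lambda>(u, v). {u<..<v}) (G i1)" "(u, v) \<noteq> (u', v')"
              using G_disj[OF mem(1)] ij(3) eq by auto
            then show ?thesis using mem True unfolding disjoint_family_on_def by fastforce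
          next
            case False
            have sub: "fst i1 \<le> u" "v \<le> snd i1" "fst j1 \<le> u'" "v' \<le> snd j1"
              using G_sub mem by blast+
            have "{fst i1..snd i1} \<inter> {fst j1..snd j1} = {}"
              using F1(3) mem False unfolding disjoint_family_on_def by (auto simp: case_prod_beta)
            moreover have "{u<..<v} \<subseteq> {fst i1..snd i1}" "{u'<..<v'} \<subseteq> {fst j1..snd j1}"
              using sub by auto
            ultimately show ?thesis by blast
          qed
          then show "{fst (snd i)<..<snd (snd i)} \<inter> {fst (snd j)<..<snd (snd j)} = {}"
            by (simp add: eq)
        qed
        show "(\<Sum>i\<in>I. snd (snd i) - fst (snd i)) < \<delta>"
          using sum_I[of "\<lambda>x. x"] L1 mL2 \<epsilon> by (simp add: L1_def L2_def)
      qed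
      have "0 \<le> (\<Sum>i\<in>I. snd (snd i) - fst (snd i))"
        using G_sub unfolding I_def by (intro sum_nonneg) auto
      then have gap: "0 \<le> L1 - L2" using sum_I[of "\<lambda>x. x"] by (simp add: L1_def L2_def)
      have "q * L2 \<le> (\<Sum>(u, v)\<in>F2. f v - f u)"
        unfolding L2_def sum_distrib_left using F2D by (intro sum_mono) auto
      moreover have "(\<Sum>(u, v)\<in>F1. f v - f u) \<le> p * L1"
        unfolding L1_def sum_distrib_left using F1D by (intro sum_mono) auto
      moreover have "\<bar>\<Sum>i\<in>I. f (snd (snd i)) - f (fst (snd i))\<bar> < \<eta>"
        using small by (intro order.strict_trans1[OF sum_abs]) simp
      ultimately have "q * L2 - p * L1 < \<eta>" using sum_I[of f] by linarith
      moreover have "p * (L1 - L2) \<le> \<bar>p\<bar> * (4 * \<epsilon>)"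
        using gap L1 mL2 by (intro mult_mono) auto
      moreover have "(q - p) * (m - 2 * \<epsilon>) \<le> (q - p) * L2"
        using pq mL2 by (intro mult_left_mono) auto
      ultimately have "(q - p) * m < \<eta> + c * \<epsilon>"
        unfolding c_def by (simp add: algebra_simps)
      then show False using \<epsilon>(3) \<open>\<eta> > 0\<close> by (simp add: \<eta>_def)
    qed
  qed
  then show ?thesis
    unfolding negligible_outer using m_approx unfolding \<T>_def
    by (smt (verit) mem_Collect_eq)
qed

text \<open>A disjoint family of intervals with slopes above \<open>n\<close> has length at most its
  total increment divided by \<open>n\<close>, and that increment is below 1 as long as the length
  is below \<open>\<delta>\<close>. Working inside small balls guarantees the latter, and
  negligibility is a local property.\<close>

lemma negligible_infinite_slope:
  fixes f :: "real \<Rightarrow> real"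
  assumes ac: "abs_cont_on a b f"
  shows "negligible {x \<in> {a..b}. \<forall>n::nat. frequent_slope a b f (\<lambda>s. real n < s) x}"
    (is "negligible ?S")
proof (rule abs_cont_on_family[OF ac zero_less_one, where 'i = "real \<times> real"])
  fix \<delta> :: real
  assume "\<delta> > 0" and \<delta>: "\<And>(I::(real \<times> real) set) u v.
    \<lbrakk>finite I; \<And>i. i \<in> I \<Longrightarrow> a \<le> u i \<and> u i \<le> v i \<and> v i \<le> b;
     disjoint_family_on (\<lambda>i. {u i<..<v i}) I; (\<Sum>i\<in>I. v i - u i) < \<delta>\<rbrakk>
    \<Longrightarrow> (\<Sum>i\<in>I. norm (f (v i) - f (u i))) < 1"
  have "negligible (?S \<inter> ball x0 (\<delta> / 4))" (is "negligible ?ball") for x0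
    unfolding negligible_outer
  proof (intro allI impI)
    fix e :: real assume "e > 0"
    then obtain n :: nat where n: "1 / (e / 2) < real n" "n > 0"
      by (metis gr_zeroI not_less_iff_gr_or_eq of_nat_0 reals_Archimedean2 zero_less_divide_1_iff half_gt_zero)
    \<comment> \<open>A point within \<open>\<delta> / 4\<close> of \<open>x0\<close> and an
      interval around it of length below \<open>\<delta> / 12\<close> stay in this ball, whose
      length \<open>2 * \<delta> / 3\<close> is below \<open>\<delta>\<close>.\<close>
    define K where "K = {(u, v). a \<le> u \<and> u < v \<and> v \<le> b \<and> {u..v} \<subseteq> ball x0 (\<delta> / 3) \<and> real n < (f v - f u) / (v - u)}"
    obtain F T where F: "finite F" "F \<subseteq> K" "disjoint_family_on (\<lambda>(u, v). {u..v}) F"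
      and T: "T \<in> lmeasurable" "measure lebesgue T < e / 2" "?ball \<subseteq> (\<Union>(u, v)\<in>F. {u..v}) \<union> T"
    proof (rule Vitali_covering_intervals[where K = K and S = ?ball and a = a and b = b and e = "e / 2"])
      fix x d :: real assume x: "x \<in> ?ball" "0 < d"
      have "frequent_slope a b f (\<lambda>s. real n < s) x" using x by blast
      then obtain u v where uv: "a \<le> u" "v \<le> b" "u < v" "u \<le> x" "x \<le> v" "v - u < min d (\<delta> / 12)"
        "real n < (f v - f u) / (v - u)"
        using x(2) \<open>\<delta> > 0\<close> by (auto elim!: frequent_slopeE[of a b f "\<lambda>s. real n < s" x "min d (\<delta> / 12)"])
      have "{u..v} \<subseteq> ball x0 (\<delta> / 3)"
      proof
        fix y assume "y \<in> {u..v}"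
        then have "\<bar>x - y\<bar> < \<delta> / 12" using uv(4,5,6) by (auto simp: abs_if)
        moreover have "\<bar>x0 - x\<bar> < \<delta> / 4" using x by (auto simp: dist_real_def)
        ultimately show "y \<in> ball x0 (\<delta> / 3)" unfolding mem_ball dist_real_def by linarith
      qed
      then show "\<exists>u v. (u, v) \<in> K \<and> x \<in> {u..v} \<and> v - u < d"
        using uv by (intro exI[of _ u] exI[of _ v]) (auto simp: K_def)
    qed (use \<open>e > 0\<close> in \<open>auto simp: K_def\<close>)
    have FD: "a \<le> u \<and> u < v \<and> v \<le> b \<and> {u..v} \<subseteq> ball x0 (\<delta> / 3) \<and> real n * (v - u) \<le> f v - f u"
      if "(u, v) \<in> F" for u v
      using that F(2) by (auto simp: K_def field_simps)
    let ?A = "\<Union>(u, v)\<in>F. {u..v}"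
    have A: "?A \<in> lmeasurable" using F(1) by (intro fmeasurable.finite_UN) auto
    have L: "measure lebesgue ?A = (\<Sum>(u, v)\<in>F. v - u)"
      using F FD by (intro measure_disjoint_intervals) (auto intro: less_imp_le)
    have "measure lebesgue ?A \<le> measure lebesgue (ball x0 (\<delta> / 3))"
      using FD A by (intro measure_mono_fmeasurable) (auto simp: fmeasurableD)
    also have "\<dots> = 2 * \<delta> / 3"
      using \<open>\<delta> > 0\<close> by (simp add: ball_eq_greaterThanLessThan)
    finally have "(\<Sum>i\<in>F. snd i - fst i) < \<delta>" using L \<open>\<delta> > 0\<close> by (simp add: case_prod_beta)
    then have "(\<Sum>i\<in>F. norm (f (snd i) - f (fst i))) < 1"
    proof (intro \<delta>)
      show "disjoint_family_on (\<lambda>i. {fst i<..<snd i}) F"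
        using F(3) by (fastforce simp: disjoint_family_on_def case_prod_beta)
      show "a \<le> fst i \<and> fst i \<le> snd i \<and> snd i \<le> b" if "i \<in> F" for i
        using FD[of "fst i" "snd i"] that by auto
    qed (use F(1) in auto)
    moreover have "real n * measure lebesgue ?A \<le> (\<Sum>i\<in>F. norm (f (snd i) - f (fst i)))"
      unfolding L sum_distrib_left using FD by (intro sum_mono) fastforce
    ultimately have "real n * measure lebesgue ?A < 1" by simp
    then have "measure lebesgue ?A < 1 / real n" using n(2) by (simp add: field_simps)
    also have "\<dots> < e / 2" using n \<open>e > 0\<close> by (simp add: field_simps)
    finally have "measure lebesgue (?A \<union> T) < e"
      using measure_Un_le[of ?A lebesgue T] A T by (simp add: fmeasurableD)
    then show "\<exists>T. ?ball \<subseteq> T \<and> T \<in> lmeasurable \<and> measure lebesgue T < e"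
      using A T by (intro exI[of _ "?A \<union> T"] conjI fmeasurable.Un) auto
  qed
  then have "\<exists>V. openin (top_of_set ?S) V \<and> x \<in> V \<and> negligible V" if "x \<in> ?S" for x
    using that \<open>\<delta> > 0\<close> by (intro exI[of _ "?S \<inter> ball x (\<delta> / 4)"]) (auto intro: openin_open_Int)
  then show ?thesis unfolding locally_negligible_alt[of ?S] by blast
qed

text \<open>The candidate \<open>L\<close> is the upper derivate, the infimum of the numbers that
  eventually bound the quotients from above; \<open>up\<close> and \<open>lo\<close> make it finite.
  For rationals \<open>p < q'\<close> below \<open>L\<close>, slopes above \<open>q'\<close> recur,
  so by \<open>two\<close> slopes below \<open>p\<close> do not. Hence the lower derivate is also
  \<open>L\<close>.\<close>

lemma differentiable_if_slopes_converge:
  fixes f :: "real \<Rightarrow> real"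
  assumes x: "x \<in> {a<..<b}"
    and two: "\<And>p q. \<lbrakk>p \<in> \<rat>; q \<in> \<rat>; p < q; frequent_slope a b f (\<lambda>s. s < p) x\<rbrakk> \<Longrightarrow> \<not> frequent_slope a b f (\<lambda>s. q < s) x"
    and up: "\<not> frequent_slope a b f (\<lambda>s. n < s) x"
    and lo: "\<not> frequent_slope a b f (\<lambda>s. s < k) x"
  shows "f differentiable (at x)"
proof -
  define Q where "Q = {q. \<not> frequent_slope a b f (\<lambda>s. q < s) x}"
  have ev: "\<exists>d>0. \<forall>h. \<bar>h\<bar> < d \<and> h \<noteq> 0 \<longrightarrow> \<not> R ((f (x + h) - f x) / h)"
    if R: "\<not> frequent_slope a b f R x" for R
  proof -
    obtain d where "d > 0" and nex: "\<nexists>u v. a \<le> u \<and> v \<le> b \<and> u < v \<and> u \<le> x \<and> x \<le> v \<and> v - u < d \<and> R ((f v - f u) / (v - u))"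
      using R unfolding frequent_slope_def not_all not_imp by (elim exE conjE) (rule that)
    then have d: "d > 0" "\<And>u v. \<lbrakk>a \<le> u; v \<le> b; u < v; u \<le> x; x \<le> v; v - u < d\<rbrakk> \<Longrightarrow> \<not> R ((f v - f u) / (v - u))"
      by blast+
    have "\<not> R ((f (x + h) - f x) / h)" if "\<bar>h\<bar> < Min {d, x - a, b - x}" "h \<noteq> 0" for h
    proof (cases "h > 0")
      case True
      then show ?thesis using d(2)[of x "x + h"] that x by auto
    next
      case False
      have "(f x - f (x + h)) / (- h) = (f (x + h) - f x) / h"
        by (simp add: divide_simps)
      then show ?thesis using d(2)[of "x + h" x] that x False by auto
    qed
    then show ?thesis using d(1) x by (intro exI[of _ "Min {d, x - a, b - x}"]) auto
  qed
  have "n \<in> Q" using up by (simp add: Q_def)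
  have lower: "k \<le> q" if "q \<in> Q" for q
  proof -
    have "\<not> frequent_slope a b f (\<lambda>s. q < s) x" using that by (simp add: Q_def)
    then obtain d d' where d: "d > 0" "\<forall>h. \<bar>h\<bar> < d \<and> h \<noteq> 0 \<longrightarrow> \<not> q < (f (x + h) - f x) / h"
      and d': "d' > 0" "\<forall>h. \<bar>h\<bar> < d' \<and> h \<noteq> 0 \<longrightarrow> \<not> (f (x + h) - f x) / h < k"
      using ev[of "\<lambda>s. q < s"] ev[of "\<lambda>s. s < k"] lo by blast
    have "\<bar>min d d' / 2\<bar> < d" "\<bar>min d d' / 2\<bar> < d'" "min d d' / 2 \<noteq> 0" using d(1) d'(1) by auto
    then have "\<not> q < (f (x + min d d' / 2) - f x) / (min d d' / 2)" "\<not> (f (x + min d d' / 2) - f x) / (min d d' / 2) < k"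
      using d(2) d'(2) by blast+
    then show ?thesis by linarith
  qed
  then have bdd: "bdd_below Q" by (rule bdd_belowI)
  define L where "L = Inf Q"
  have "(\<lambda>h. (f (x + h) - f x) / h) \<midarrow>0\<rightarrow> L"
  proof (rule LIM_I)
    fix e :: real assume "e > 0"
    obtain q where "q \<in> Q" "q < L + e"
      using cInf_lessD[of Q "L + e"] \<open>n \<in> Q\<close> \<open>e > 0\<close> by (auto simp: L_def)
    then obtain d where d: "d > 0" "\<forall>h. \<bar>h\<bar> < d \<and> h \<noteq> 0 \<longrightarrow> \<not> q < (f (x + h) - f x) / h"
      using ev[of "\<lambda>s. q < s"] by (auto simp: Q_def)
    obtain p where p: "p \<in> \<rat>" "L - e < p" "p < L" using Rats_dense_in_real[of "L - e" L] \<open>e > 0\<close> by auto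
    obtain q' where q': "q' \<in> \<rat>" "p < q'" "q' < L" using Rats_dense_in_real[of p L] p by auto
    have "q' \<notin> Q" using q'(3) cInf_lower[OF _ bdd, of q'] by (auto simp: L_def)
    then have "\<not> frequent_slope a b f (\<lambda>s. s < p) x"
      using two[OF p(1) q'(1) q'(2)] by (auto simp: Q_def)
    then obtain d' where d': "d' > 0" "\<forall>h. \<bar>h\<bar> < d' \<and> h \<noteq> 0 \<longrightarrow> \<not> (f (x + h) - f x) / h < p"
      using ev by blast
    have "norm ((f (x + h) - f x) / h - L) < e" if "h \<noteq> 0" "norm (h - 0) < min d d'" for h
    proof -
      have "\<not> q < (f (x + h) - f x) / h" "\<not> (f (x + h) - f x) / h < p" using that d(2) d'(2) by auto
      then show ?thesis using \<open>q < L + e\<close> p by (auto simp: abs_less_iff)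
    qed
    then show "\<exists>s>0. \<forall>h. h \<noteq> 0 \<and> norm (h - 0) < s \<longrightarrow> norm ((f (x + h) - f x) / h - L) < e"
      using d(1) d'(1) by (intro exI[of _ "min d d'"]) auto
  qed
  then have "(f has_real_derivative L) (at x)" by (simp add: DERIV_def)
  then show ?thesis using real_differentiable_def by blast
qed

text \<open>Where differentiability fails, either two rationals separate the lower from the upper
  derivate, or the upper derivate of \<open>f\<close> or of its negative is infinite. These are
  countably many negligible cases.\<close>

theorem abs_cont_on_differentiable_ae:
  fixes f :: "real \<Rightarrow> real"
  assumes ac: "abs_cont_on a b f"
  shows "negligible {x \<in> {a<..<b}. \<not> f differentiable (at x)}"
proof -
  have ac': "abs_cont_on a b (\<lambda>x. - f x)"
    using ac unfolding abs_cont_on_def by (simp add: abs_minus_commute)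
  have neg: "frequent_slope a b (\<lambda>x. - f x) R x \<longleftrightarrow> frequent_slope a b f (\<lambda>s. R (- s)) x" for R x
  proof -
    have "(- f v - - f u) / (v - u) = - ((f v - f u) / (v - u))" for u v :: real
      by (metis minus_diff_eq minus_divide_left uminus_add_conv_diff diff_minus_eq_add)
    then show ?thesis by (simp add: frequent_slope_def)
  qed
  let ?two = "\<lambda>(p, q). {x \<in> {a..b}. frequent_slope a b f (\<lambda>s. s < p) x \<and> frequent_slope a b f (\<lambda>s. q < s) x}"
  let ?inf = "\<lambda>f. {x \<in> {a..b}. \<forall>n::nat. frequent_slope a b f (\<lambda>s. real n < s) x}"
  have "negligible (\<Union>(?two ` {(p, q). p \<in> \<rat> \<and> q \<in> \<rat> \<and> p < q}))"
  proof (rule negligible_countable_Union)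
    have "countable (\<rat> \<times> \<rat> :: (real \<times> real) set)" by (intro countable_SIGMA countable_rat)
    then show "countable (?two ` {(p, q). p \<in> \<rat> \<and> q \<in> \<rat> \<and> p < q})"
      by (rule countable_image[OF countable_subset, rotated]) auto
  qed (use negligible_two_slopes[OF ac] in auto)
  then have "negligible (\<Union>(?two ` {(p, q). p \<in> \<rat> \<and> q \<in> \<rat> \<and> p < q}) \<union> (?inf f \<union> ?inf (\<lambda>x. - f x)))"
    using negligible_infinite_slope[OF ac] negligible_infinite_slope[OF ac'] by (intro negligible_Un)
  then show ?thesis
  proof (rule negligible_subset, intro subsetI)
    fix x assume x: "x \<in> {x \<in> {a<..<b}. \<not> f differentiable (at x)}"
    show "x \<in> \<Union>(?two ` {(p, q). p \<in> \<rat> \<and> q \<in> \<rat> \<and> p < q}) \<union> (?inf f \<union> ?inf (\<lambda>x. - f x))"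
    proof (rule ccontr)
      assume not: "x \<notin> \<Union>(?two ` {(p, q). p \<in> \<rat> \<and> q \<in> \<rat> \<and> p < q}) \<union> (?inf f \<union> ?inf (\<lambda>x. - f x))"
      have xab: "x \<in> {a..b}" using x by auto
      obtain n k :: nat where n: "\<not> frequent_slope a b f (\<lambda>s. real n < s) x"
        and k0: "\<not> frequent_slope a b f (\<lambda>s. real k < - s) x"
        using not xab neg by blast
      have k: "\<not> frequent_slope a b f (\<lambda>s. s < - real k) x"
        using k0 by (simp add: less_minus_iff)
      have "f differentiable (at x)"
      proof (rule differentiable_if_slopes_converge[OF _ _ n k])
        fix p q :: real assume "p \<in> \<rat>" "q \<in> \<rat>" "p < q" "frequent_slope a b f (\<lambda>s. s < p) x"
        then show "\<not> frequent_slope a b f (\<lambda>s. q < s) x" using not xab by auto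
      qed (use x in auto)
      then show False using x by simp
    qed
  qed
qed

section \<open>Increments of absolutely continuous functions\<close>

lemma abs_cont_on_subinterval:
  assumes "abs_cont_on a b f" "a \<le> c" "d \<le> b"
  shows "abs_cont_on c d f"
proof -
  have "disj_intervals a b n t s" if "disj_intervals c d n t s" for n t s
    using that assms(2,3) unfolding disj_intervals_def by (meson order_trans)
  then show ?thesis using assms(1) unfolding abs_cont_on_def by meson
qed

lemma abs_cont_on_dominated:
  assumes ac: "abs_cont_on a b f" and "0 < L"
    and le: "\<And>s t. \<lbrakk>s \<in> {a..b}; t \<in> {a..b}\<rbrakk> \<Longrightarrow> norm (h s - h t) \<le> L * norm (f s - f t)"
  shows "abs_cont_on a b h"
  unfolding abs_cont_on_def
proof (intro allI impI)
  fix e :: real assume "e > 0"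
  then have "e / L > 0" using \<open>0 < L\<close> by simp
  then obtain d where "d > 0" and d: "\<forall>n t s. disj_intervals a b n t s \<and> (\<Sum>i<n. s i - t i) < d
        \<longrightarrow> (\<Sum>i<n. norm (f (s i) - f (t i))) < e / L"
    using ac unfolding abs_cont_on_def by meson
  have "(\<Sum>i<n. norm (h (s i) - h (t i))) < e"
    if di: "disj_intervals a b n t s" "(\<Sum>i<n. s i - t i) < d" for n t s
  proof -
    have mem: "t i \<in> {a..b}" "s i \<in> {a..b}" if "i < n" for i
      using di(1) that unfolding disj_intervals_def by fastforce+
    have "(\<Sum>i<n. norm (h (s i) - h (t i))) \<le> (\<Sum>i<n. L * norm (f (s i) - f (t i)))"
      using mem by (intro sum_mono le) auto
    also have "\<dots> = L * (\<Sum>i<n. norm (f (s i) - f (t i)))" by (simp add: sum_distrib_left)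
    also have "\<dots> < L * (e / L)"
      using d di \<open>0 < L\<close> by (intro mult_strict_left_mono) auto
    finally show ?thesis using \<open>0 < L\<close> by simp
  qed
  then show "\<exists>d>0. \<forall>n t s. disj_intervals a b n t s \<and> (\<Sum>i<n. s i - t i) < d
        \<longrightarrow> (\<Sum>i<n. norm (h (s i) - h (t i))) < e"
    using \<open>d > 0\<close> by blast
qed

text \<open>Above \<open>m\<close> the logarithm is Lipschitz with constant
  \<open>1 / m\<close>.\<close>

lemma abs_cont_on_ln:
  fixes g :: "real \<Rightarrow> real"
  assumes "abs_cont_on a b g" "0 < m" and m: "\<And>t. t \<in> {a..b} \<Longrightarrow> m \<le> g t"
  shows "abs_cont_on a b (\<lambda>t. ln (g t))"
proof (rule abs_cont_on_dominated[OF assms(1), of "1 / m"])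
  have le: "ln x - ln y \<le> 1 / m * \<bar>x - y\<bar>" if "m \<le> x" "m \<le> y" for x y
  proof -
    have "ln x - ln y \<le> (x - y) / y" using that \<open>0 < m\<close> by (intro ln_diff_le) auto
    also have "\<dots> \<le> \<bar>x - y\<bar> / y" using that \<open>0 < m\<close> by (intro divide_right_mono) auto
    also have "\<dots> \<le> \<bar>x - y\<bar> / m" using that \<open>0 < m\<close> by (intro divide_left_mono) auto
    finally show ?thesis by simp
  qed
  show "norm (ln (g s) - ln (g t)) \<le> 1 / m * norm (g s - g t)" if "s \<in> {a..b}" "t \<in> {a..b}" for s t
    using le[of "g s" "g t"] le[of "g t" "g s"] m that by (simp add: abs_le_iff abs_minus_commute)
qed (use \<open>0 < m\<close> in simp)

text \<open>Riemann sums of \<open>K\<close> are compared directly with the telescoping sum of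
  \<open>G\<close>. A cell with a good tag has increment at most \<open>K\<close> plus a small
  slack, times its length; cells tagged in \<open>N\<close> are forced into an open set of small
  measure, where absolute continuity controls their increments.\<close>

lemma abs_cont_on_increment_le_integral:
  fixes G K :: "real \<Rightarrow> real"
  assumes ac: "abs_cont_on c d G" and "c \<le> d" and K: "K integrable_on {c..d}" and N: "negligible N"
    and der: "\<And>t. t \<in> {c..d} - N \<Longrightarrow> \<exists>D. (G has_real_derivative D) (at t) \<and> D \<le> K t"
  shows "G d - G c \<le> integral {c..d} K"
proof (rule field_le_epsilon)
  fix e :: real assume "e > 0"
  \<comment> \<open>With the value 0 on \<open>N\<close>, cells tagged there contribute nothing to
    the Riemann sum, and the integral is unchanged.\<close>
  define K' where "K' = (\<lambda>t. if t \<in> N then 0 else K t)"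
  define I where "I = integral {c..d} K"
  \<comment> \<open>One third of \<open>e\<close> each goes to the slack over the whole interval,
    the Riemann sum and the cells tagged in \<open>N\<close>. The summand 1 keeps the denominator
    positive when \<open>c = d\<close>.\<close>
  define \<epsilon> where "\<epsilon> = e / (3 * (d - c + 1))"
  have "\<epsilon> > 0" using \<open>e > 0\<close> \<open>c \<le> d\<close> by (simp add: \<epsilon>_def)
  have "\<epsilon> * (d - c) \<le> e / 3"
    using \<open>e > 0\<close> \<open>c \<le> d\<close> by (simp add: \<epsilon>_def field_simps)
  have "(K has_integral I) (cbox c d)" using K by (simp add: I_def has_integral_integral)
  then have "(K' has_integral I) (cbox c d)"
    by (rule has_integral_spike[OF N, rotated]) (auto simp: K'_def)
  then obtain \<gamma>1 where \<gamma>1: "gauge \<gamma>1" and riem: "\<And>\<D>. \<lbrakk>\<D> tagged_division_of cbox c d; \<gamma>1 fine \<D>\<rbrakk>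
      \<Longrightarrow> norm ((\<Sum>(x, k)\<in>\<D>. measure lborel k *\<^sub>R K' x) - I) < e / 3"
    using \<open>e > 0\<close> unfolding has_integral by (metis (no_types, lifting) zero_less_divide_iff zero_less_numeral)
  have "e / 3 > 0" using \<open>e > 0\<close> by simp
  show "G d - G c \<le> integral {c..d} K + e"
  proof (rule abs_cont_on_family[OF ac \<open>e / 3 > 0\<close>, where 'i = "real \<times> real set"])
    fix \<delta> :: real
    assume "\<delta> > 0" and \<delta>: "\<And>(I::(real \<times> real set) set) u v.
      \<lbrakk>finite I; \<And>i. i \<in> I \<Longrightarrow> c \<le> u i \<and> u i \<le> v i \<and> v i \<le> d;
       disjoint_family_on (\<lambda>i. {u i<..<v i}) I; (\<Sum>i\<in>I. v i - u i) < \<delta>\<rbrakk>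
      \<Longrightarrow> (\<Sum>i\<in>I. norm (G (v i) - G (u i))) < e / 3"
    obtain U where U: "open U" "N \<subseteq> U" "U \<in> lmeasurable" "measure lebesgue U < \<delta>"
      using lmeasurable_outer_open[OF negligible_imp_measurable[OF N] \<open>\<delta> > 0\<close>] negligible_imp_measure0[OF N]
      by auto
    \<comment> \<open>Straddle estimate: adding the first-order errors at \<open>u\<close> and
      \<open>v\<close> on either side of \<open>t\<close> gives an error proportional to
      \<open>v - u\<close>.\<close>
    have "\<exists>r>0. \<forall>u v. u \<le> t \<and> t \<le> v \<and> {u..v} \<subseteq> ball t r \<longrightarrow> G v - G u \<le> (K t + \<epsilon>) * (v - u)"
      if t: "t \<in> {c..d} - N" for t
    proof -
      obtain D where D: "(G has_real_derivative D) (at t)" "D \<le> K t" using der[OF t] by blast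
      then obtain r where r: "r > 0" "\<And>y. norm (y - t) < r \<Longrightarrow> norm (G y - G t - D * (y - t)) \<le> \<epsilon> * norm (y - t)"
        using \<open>\<epsilon> > 0\<close> unfolding has_field_derivative_def has_derivative_at_alt by blast
      have "G v - G u \<le> (K t + \<epsilon>) * (v - u)" if "u \<le> t" "t \<le> v" "{u..v} \<subseteq> ball t r" for u v
      proof -
        have "u \<in> {u..v}" "v \<in> {u..v}" using that by auto
        then have "norm (u - t) < r" "norm (v - t) < r"
          using that(3) by (metis subsetD mem_ball dist_commute dist_norm)+
        then have "\<bar>G u - G t - D * (u - t)\<bar> \<le> \<epsilon> * (t - u)" "\<bar>G v - G t - D * (v - t)\<bar> \<le> \<epsilon> * (v - t)"
          using r(2)[of u] r(2)[of v] that by auto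
        then have "G v - G u \<le> (D + \<epsilon>) * (v - u)" by (simp add: algebra_simps abs_le_iff)
        also have "\<dots> \<le> (K t + \<epsilon>) * (v - u)" using D(2) that by (intro mult_right_mono) auto
        finally show ?thesis .
      qed
      then show ?thesis using r(1) by blast
    qed
    then obtain r where r: "\<And>t. t \<in> {c..d} - N \<Longrightarrow> r t > 0"
      "\<And>t u v. \<lbrakk>t \<in> {c..d} - N; u \<le> t; t \<le> v; {u..v} \<subseteq> ball t (r t)\<rbrakk> \<Longrightarrow> G v - G u \<le> (K t + \<epsilon>) * (v - u)"
      by metis
    define \<gamma> where "\<gamma> t = \<gamma>1 t \<inter> (if t \<in> N then U else if t \<in> {c..d} then ball t (r t) else UNIV)" for t
    have "gauge \<gamma>" using \<gamma>1 U(1,2) r(1) unfolding gauge_def \<gamma>_def by auto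
    then obtain \<D> where \<D>: "\<D> tagged_division_of {c..d}" "\<gamma> fine \<D>"
      using fine_division_exists_real by blast
    then have "\<gamma>1 fine \<D>" unfolding fine_def \<gamma>_def by blast
    have div: "\<D> tagged_division_of cbox c d" using \<D>(1) by simp
    have fin: "finite \<D>" using div by auto
    have int: "c \<le> Inf k \<and> Inf k \<le> x \<and> x \<le> Sup k \<and> Sup k \<le> d \<and> k = {Inf k..Sup k} \<and> measure lborel k = Sup k - Inf k"
      if mem: "(x, k) \<in> \<D>" for x k
    proof -
      obtain u v where "k = cbox u v" using tagged_division_ofD(4)[OF div mem] by blast
      moreover have "x \<in> k" "k \<subseteq> cbox c d"
        using tagged_division_ofD(2,3)[OF div mem] by auto
      ultimately show ?thesis by auto
    qed
    define \<D>N where "\<D>N = {p \<in> \<D>. fst p \<in> N}"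
    have "\<D>N \<subseteq> \<D>" by (auto simp: \<D>N_def)
    have disj: "disjoint_family_on (\<lambda>i. {Inf (snd i)<..<Sup (snd i)}) \<D>N"
      unfolding disjoint_family_on_def
    proof (intro ballI impI)
      fix i j assume "i \<in> \<D>N" "j \<in> \<D>N" "i \<noteq> j"
      then have ij: "(fst i, snd i) \<in> \<D>" "(fst j, snd j) \<in> \<D>" "(fst i, snd i) \<noteq> (fst j, snd j)"
        by (auto simp: \<D>N_def)
      have "interior (snd i) = {Inf (snd i)<..<Sup (snd i)}" "interior (snd j) = {Inf (snd j)<..<Sup (snd j)}"
        using int[OF ij(1)] int[OF ij(2)] by (metis interior_atLeastAtMost_real)+
      then show "{Inf (snd i)<..<Sup (snd i)} \<inter> {Inf (snd j)<..<Sup (snd j)} = {}"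
        using tagged_division_ofD(5)[OF div ij] by simp
    qed
    have "(\<Sum>i\<in>\<D>N. norm (G (Sup (snd i)) - G (Inf (snd i)))) < e / 3"
    proof (rule \<delta>[OF _ _ disj])
      show "finite \<D>N" using fin \<open>\<D>N \<subseteq> \<D>\<close> by (rule finite_subset[rotated])
      show "c \<le> Inf (snd i) \<and> Inf (snd i) \<le> Sup (snd i) \<and> Sup (snd i) \<le> d" if "i \<in> \<D>N" for i
        using int[of "fst i" "snd i"] that by (auto simp: \<D>N_def)
      have "(\<Sum>i\<in>\<D>N. Sup (snd i) - Inf (snd i)) = (\<Sum>i\<in>\<D>N. measure lebesgue {Inf (snd i)<..<Sup (snd i)})"
      proof (rule sum.cong)
        fix i assume "i \<in> \<D>N"
        then have "Inf (snd i) \<le> Sup (snd i)"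
          using int[of "fst i" "snd i"] by (auto simp: \<D>N_def)
        then show "Sup (snd i) - Inf (snd i) = measure lebesgue {Inf (snd i)<..<Sup (snd i)}" by simp
      qed simp
      also have "\<dots> = measure lebesgue (\<Union>i\<in>\<D>N. {Inf (snd i)<..<Sup (snd i)})"
        using disj \<open>finite \<D>N\<close>
        by (intro measure_UNION'[symmetric]) (auto simp: pairwise_def disjnt_def disjoint_family_on_def)
      also have "\<dots> \<le> measure lebesgue U"
      proof (rule measure_mono_fmeasurable)
        show "(\<Union>i\<in>\<D>N. {Inf (snd i)<..<Sup (snd i)}) \<subseteq> U"
        proof (rule UN_least)
          fix i assume "i \<in> \<D>N"
          then have i: "(fst i, snd i) \<in> \<D>" "fst i \<in> N" by (auto simp: \<D>N_def)
          then have "snd i \<subseteq> U" using fineD[OF \<D>(2) i(1)] by (auto simp: \<gamma>_def)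
          moreover have "{Inf (snd i)<..<Sup (snd i)} \<subseteq> snd i"
            using int[OF i(1)] by (metis greaterThanLessThan_subseteq_atLeastAtMost_iff order_refl)
          ultimately show "{Inf (snd i)<..<Sup (snd i)} \<subseteq> U" by blast
        qed
      qed (use U(3) \<open>finite \<D>N\<close> in \<open>auto intro!: sets.finite_UN\<close>)
      finally show "(\<Sum>i\<in>\<D>N. Sup (snd i) - Inf (snd i)) < \<delta>" using U(4) by simp
    qed
    then have small: "(\<Sum>p\<in>\<D>. if fst p \<in> N then \<bar>G (Sup (snd p)) - G (Inf (snd p))\<bar> else 0) < e / 3"
      unfolding \<D>N_def using fin by (simp add: sum.inter_filter)
    have pw: "G (Sup k) - G (Inf k) \<le> (if x \<in> N then \<bar>G (Sup k) - G (Inf k)\<bar> else 0) + measure lborel k *\<^sub>R K' x + \<epsilon> * measure lborel k"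
      if mem: "(x, k) \<in> \<D>" for x k
    proof (cases "x \<in> N")
      case True
      then show ?thesis using \<open>\<epsilon> > 0\<close> by (simp add: K'_def add_increasing2)
    next
      case False
      have x: "x \<in> {c..d} - N" using False int[OF mem] by auto
      have "k \<subseteq> ball x (r x)" using fineD[OF \<D>(2) mem] x by (auto simp: \<gamma>_def)
      then have "{Inf k..Sup k} \<subseteq> ball x (r x)" using int[OF mem] by simp
      then have "G (Sup k) - G (Inf k) \<le> (K x + \<epsilon>) * (Sup k - Inf k)"
        using int[OF mem] by (intro r(2)[OF x]) auto
      moreover have "Sup k - Inf k = measure lborel k" using int[OF mem] by simp
      ultimately have "G (Sup k) - G (Inf k) \<le> (K x + \<epsilon>) * measure lborel k" by simp
      then show ?thesis using False by (simp add: K'_def algebra_simps)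
    qed
    have "G d - G c = (\<Sum>(x, k)\<in>\<D>. G (Sup k) - G (Inf k))"
      using additive_tagged_division_1[OF \<open>c \<le> d\<close> \<D>(1), of G] by simp
    also have "\<dots> \<le> (\<Sum>p\<in>\<D>. (if fst p \<in> N then \<bar>G (Sup (snd p)) - G (Inf (snd p))\<bar> else 0)
        + measure lborel (snd p) *\<^sub>R K' (fst p) + \<epsilon> * measure lborel (snd p))"
      using pw by (intro sum_mono) (auto simp: case_prod_beta)
    also have "\<dots> = (\<Sum>p\<in>\<D>. if fst p \<in> N then \<bar>G (Sup (snd p)) - G (Inf (snd p))\<bar> else 0)
        + (\<Sum>(x, k)\<in>\<D>. measure lborel k *\<^sub>R K' x) + \<epsilon> * (\<Sum>(x, k)\<in>\<D>. measure lborel k)"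
      by (simp add: sum.distrib sum_distrib_left case_prod_beta)
    also have "(\<Sum>(x, k)\<in>\<D>. measure lborel k) = d - c"
      using additive_content_tagged_division[OF div] \<open>c \<le> d\<close> by simp
    finally show ?thesis
      using small riem[OF div \<open>\<gamma>1 fine \<D>\<close>] \<open>\<epsilon> * (d - c) \<le> e / 3\<close>
      unfolding I_def real_norm_def by linarith
  qed
qed

section \<open>Contingent cones and tubes\<close>

text \<open>The cone supplies arbitrarily small \<open>\<tau>\<close> and points of \<open>K\<close>
  within \<open>e * \<tau>\<close> of \<open>w + \<tau> *\<^sub>R v\<close>. Expanding
  \<open>f\<close> there to first order and dividing by \<open>\<tau>\<close> leaves an error of
  order \<open>e\<close>. Nonemptiness of \<open>K\<close> matters: \<open>infdist\<close> to the
  empty set is 0, which would put every vector in the cone.\<close>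

lemma derivative_nonneg_contingent_cone:
  fixes f :: "'a::real_normed_vector \<Rightarrow> real"
  assumes f: "(f has_derivative f') (at w)" and "f w = 0"
    and K: "\<And>x. x \<in> K \<Longrightarrow> 0 \<le> f x" and "K \<noteq> {}"
    and v: "v \<in> contingent_cone K w"
  shows "0 \<le> f' v"
proof -
  interpret f': bounded_linear f' using f by (rule has_derivative_bounded_linear)
  obtain B where B: "B > 0" "\<And>h. norm (f' h) \<le> norm h * B" using f'.pos_bounded by blast
  have le: "- (e * (B + norm v + 1)) \<le> f' v" if e: "0 < e" "e < 1" for e
  proof -
    obtain r where r: "r > 0" "\<And>y. norm (y - w) < r \<Longrightarrow> norm (f y - f w - f' (y - w)) \<le> e * norm (y - w)"
      using f e unfolding has_derivative_at_alt by blast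
    let ?q = "\<lambda>\<tau>::real. ereal (infdist (w + \<tau> *\<^sub>R v) K / \<tau>)"
    have "\<not> eventually (\<lambda>\<tau>. ereal e \<le> ?q \<tau>) (at_right 0)"
    proof
      assume "eventually (\<lambda>\<tau>. ereal e \<le> ?q \<tau>) (at_right 0)"
      then have "ereal e \<le> Liminf (at_right 0) ?q" by (rule Liminf_bounded)
      then show False using v e by (simp add: contingent_cone_def)
    qed
    \<comment> \<open>The chosen point of \<open>K\<close> lies within
      \<open>\<tau> * (norm v + 1)\<close> of \<open>w\<close>, so this keeps it where the expansion
      is valid.\<close>
    moreover have "eventually (\<lambda>\<tau>. \<tau> < r / (norm v + 1)) (at_right 0)"
      using r(1) by (intro order_tendstoD(2)[OF tendsto_ident_at]) (simp add: add_nonneg_pos)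
    moreover have "eventually (\<lambda>\<tau>. (0::real) < \<tau>) (at_right 0)"
      by (rule eventually_at_right_less)
    ultimately have "\<exists>\<tau>. \<tau> < r / (norm v + 1) \<and> 0 < \<tau> \<and> \<not> ereal e \<le> ?q \<tau>"
      by (smt (verit) eventually_elim2)
    then obtain \<tau> where \<tau>: "0 < \<tau>" "\<tau> < r / (norm v + 1)" "infdist (w + \<tau> *\<^sub>R v) K < e * \<tau>"
      by (auto simp: field_simps not_le)
    then obtain x where x: "x \<in> K" "dist (w + \<tau> *\<^sub>R v) x < e * \<tau>"
      using \<open>K \<noteq> {}\<close> by (auto simp: infdist_notempty cINF_less_iff)
    define h where "h = x - (w + \<tau> *\<^sub>R v)"
    have h: "norm h < e * \<tau>" "x - w = \<tau> *\<^sub>R v + h"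
      using x(2) by (auto simp: h_def dist_norm norm_minus_commute)
    have "norm (x - w) \<le> \<tau> * norm v + e * \<tau>"
      using norm_triangle_ineq[of "\<tau> *\<^sub>R v" h] h \<tau>(1) by simp
    also have "\<dots> \<le> \<tau> * (norm v + 1)" using e \<tau>(1) by (simp add: distrib_left)
    finally have xw: "norm (x - w) \<le> \<tau> * (norm v + 1)" .
    also have "\<dots> < r" using \<tau>(2) by (simp add: pos_less_divide_eq add_nonneg_pos)
    finally have "\<bar>f x - f' (x - w)\<bar> \<le> e * norm (x - w)"
      using r(2)[of x] \<open>f w = 0\<close> by simp
    also have "\<dots> \<le> e * (\<tau> * (norm v + 1))" using xw e by (intro mult_left_mono) auto
    finally have "0 \<le> f' (x - w) + e * (\<tau> * (norm v + 1))" using K[OF x(1)] by linarith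
    moreover have "f' (x - w) = \<tau> * f' v + f' h" by (simp add: h(2) f'.add f'.scaleR)
    moreover have "f' h \<le> e * \<tau> * B"
      using B(2)[of h] mult_right_mono[OF less_imp_le[OF h(1)] less_imp_le[OF B(1)]] by simp
    ultimately have "0 \<le> \<tau> * (f' v + e * (B + norm v + 1))" by (simp add: algebra_simps)
    then show ?thesis using \<tau>(1) by (simp add: zero_le_mult_iff)
  qed
  show ?thesis
  proof (rule ccontr)
    assume neg: "\<not> 0 \<le> f' v"
    define c where "c = B + norm v + 1"
    have "c > 0" using B(1) by (simp add: c_def add_pos_nonneg)
    define e where "e = min (1 / 2) (- f' v / (2 * c))"
    have "0 < e" "e < 1" using neg \<open>c > 0\<close> by (auto simp: e_def divide_neg_pos)
    moreover have "e * c \<le> - f' v / (2 * c) * c" using \<open>c > 0\<close> by (intro mult_right_mono) (auto simp: e_def)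
    ultimately show False using le[of e] neg \<open>c > 0\<close> by (simp add: c_def[symmetric])
  qed
qed

lemma derivative_nonneg_convex_contingent_cone:
  fixes f :: "'a::real_normed_vector \<Rightarrow> real"
  assumes f: "(f has_derivative f') (at w)" "f w = 0" "\<And>x. x \<in> K \<Longrightarrow> 0 \<le> f x" "K \<noteq> {}"
    and v: "v \<in> closure (convex hull (contingent_cone K w))"
  shows "0 \<le> f' v"
proof -
  interpret f': bounded_linear f' using f(1) by (rule has_derivative_bounded_linear)
  have "closed {v. 0 \<le> f' v}"
    by (intro closed_Collect_le continuous_on_const f'.continuous_on continuous_on_id)
  moreover have "convex {v. 0 \<le> f' v}"
    by (intro convexI) (simp add: f'.add f'.scaleR)
  moreover have "contingent_cone K w \<subseteq> {v. 0 \<le> f' v}"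
    using derivative_nonneg_contingent_cone[OF f] by blast
  ultimately have "closure (convex hull (contingent_cone K w)) \<subseteq> {v. 0 \<le> f' v}"
    by (intro closure_minimal hull_minimal)
  then show ?thesis using v by blast
qed

text \<open>The point \<open>y\<close> is fixed while time and the second argument of the test
  function vary independently. Since \<open>z t \<noteq> y\<close>, the norm is differentiable at
  \<open>z t - y\<close>; its gradient is the unit vector \<open>sgn (z t - y)\<close>, so only the
  component of \<open>v - e\<close> along it enters.\<close>

lemma infdist_tube_derivative_le:
  fixes z :: "real \<Rightarrow> 'a::real_inner"
  assumes z: "(z has_vector_derivative v) (at t)"
    and g: "((\<lambda>s. infdist (z s) (P s)) has_real_derivative D) (at t)"
    and t: "t \<in> {0..T}" and y: "y \<in> P t" "infdist (z t) (P t) = dist (z t) y" "z t \<noteq> y"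
    and e: "(1, e) \<in> closure (convex hull (contingent_cone (gph T P) (t, y)))"
  shows "D \<le> norm (v - e)"
proof -
  let ?f = "\<lambda>p::real \<times> 'a. norm (z (fst p) - snd p) - infdist (z (fst p)) (P (fst p))"
  let ?f' = "\<lambda>p::real \<times> 'a. (fst p *\<^sub>R v - snd p) \<bullet> sgn (z t - y) - fst p * D"
  have "(z has_derivative (\<lambda>s. s *\<^sub>R v)) (at t)"
    using z by (simp add: has_vector_derivative_def)
  then have z': "((\<lambda>p. z (fst p)) has_derivative (\<lambda>p. fst p *\<^sub>R v)) (at (t, y))"
    by (intro has_derivative_compose[of fst fst, where g = z]) (auto intro!: derivative_eq_intros)
  have "((\<lambda>s. infdist (z s) (P s)) has_derivative (\<lambda>s. s * D)) (at t)"
    using g by (simp add: has_field_derivative_def mult_commute_abs)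
  then have g': "((\<lambda>p. infdist (z (fst p)) (P (fst p))) has_derivative (\<lambda>p. fst p * D)) (at (t, y))"
    by (intro has_derivative_compose[of fst fst, where g = "\<lambda>s. infdist (z s) (P s)"])
       (auto intro!: derivative_eq_intros)
  have "((\<lambda>p. z (fst p) - snd p) has_derivative (\<lambda>p. fst p *\<^sub>R v - snd p)) (at (t, y))"
    by (intro has_derivative_diff z') (auto intro!: derivative_eq_intros)
  from has_derivative_compose[OF this has_derivative_norm]
  have "((\<lambda>p. norm (z (fst p) - snd p)) has_derivative (\<lambda>p. (fst p *\<^sub>R v - snd p) \<bullet> sgn (z t - y))) (at (t, y))"
    using y(3) by simp
  then have "(?f has_derivative ?f') (at (t, y))"
    by (intro has_derivative_diff g')
  then have "0 \<le> ?f' (1, e)"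
  proof (rule derivative_nonneg_convex_contingent_cone)
    show "gph T P \<noteq> {}" using t y(1) by (auto simp: gph_def)
    show "0 \<le> ?f x" if "x \<in> gph T P" for x
      using that by (auto simp: gph_def dist_norm[symmetric] intro!: infdist_le)
  qed (use e y(2) in \<open>auto simp: dist_norm\<close>)
  then have "D \<le> (v - e) \<bullet> sgn (z t - y)" by simp
  also have "\<dots> \<le> norm (v - e) * norm (sgn (z t - y))" by (rule norm_cauchy_schwarz)
  also have "\<dots> = norm (v - e)" using y(3) by (simp add: norm_sgn)
  finally show ?thesis .
qed

section \<open>The truncated Hausdorff distance and the distance to a moving set\<close>

lemma dK_commute: "dK K U V = dK K V U"
  unfolding dK_def by (rule arg_cong[of _ _ Inf]) auto

text \<open>A real infimum is informative only for a nonempty set, so an admissible radius has to be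
  exhibited: every point of the bounded \<open>K\<close> is within
  \<open>\<bar>B\<bar> + norm u + norm v\<close> of both \<open>u\<close> and
  \<open>v\<close>.\<close>

lemma dK_lessD:
  fixes U V :: "'a::real_normed_vector set"
  assumes "dK K U V < e" "bounded K" "U \<noteq> {}" "V \<noteq> {}"
  shows "\<exists>r. 0 \<le> r \<and> r < e \<and> U \<inter> K \<subseteq> {v + w |v w. v \<in> V \<and> norm w \<le> r} \<and>
    V \<inter> K \<subseteq> {u + w |u w. u \<in> U \<and> norm w \<le> r}"
proof -
  define S where "S = {e. e \<ge> 0 \<and> U \<inter> K \<subseteq> {v + w |v w. v \<in> V \<and> norm w \<le> e} \<and>
      V \<inter> K \<subseteq> {u + w |u w. u \<in> U \<and> norm w \<le> e}}"
  obtain B where B: "\<And>x. x \<in> K \<Longrightarrow> norm x \<le> B" using assms(2) by (auto simp: bounded_iff)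
  obtain u v where "u \<in> U" "v \<in> V" using assms(3,4) by blast
  have near: "\<exists>a w. x = a + w \<and> a \<in> A \<and> norm w \<le> \<bar>B\<bar> + norm u + norm v"
    if "x \<in> K" "a \<in> A" "a = u \<or> a = v" for x a A
  proof (intro exI conjI)
    have "norm a \<le> norm u + norm v" using that(3) by auto
    then show "norm (x - a) \<le> \<bar>B\<bar> + norm u + norm v"
      using B[OF that(1)] norm_triangle_ineq4[of x a] by linarith
  qed (use that(2) in auto)
  have "\<bar>B\<bar> + norm u + norm v \<in> S"
    unfolding S_def using near[of _ u U] near[of _ v V] \<open>u \<in> U\<close> \<open>v \<in> V\<close> by auto
  moreover have "Inf S < e" using assms(1) by (simp add: dK_def S_def)
  ultimately obtain r where "r \<in> S" "r < e" using cInf_lessD[of S e] by blast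
  then show ?thesis unfolding S_def by blast
qed

text \<open>Only a nearest point of \<open>U\<close> is moved into \<open>V\<close>, so it is enough
  that nearest points lie in the truncation set. The slack \<open>e\<close> is there because the
  infimum in \<open>dK\<close> is only approached.\<close>

lemma infdist_le_dK:
  fixes U V :: "'a::euclidean_space set"
  assumes "bounded K" "closed U" "U \<noteq> {}" "V \<noteq> {}"
    and K: "\<And>y. \<lbrakk>y \<in> U; dist x y = infdist x U\<rbrakk> \<Longrightarrow> y \<in> K"
  shows "infdist x V \<le> infdist x U + dK K U V"
proof (rule field_le_epsilon)
  fix e :: real assume "e > 0"
  obtain r where r: "r < dK K U V + e" "U \<inter> K \<subseteq> {v + w |v w. v \<in> V \<and> norm w \<le> r}"
    using dK_lessD[of K U V "dK K U V + e"] assms(1,3,4) \<open>e > 0\<close> by auto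
  obtain y where y: "y \<in> U" "infdist x U = dist x y"
    using infdist_attains_inf[OF assms(2,3)] by blast
  then have "y \<in> K" using K by simp
  then obtain v w where vw: "y = v + w" "v \<in> V" "norm w \<le> r" using r(2) y(1) by blast
  have "infdist x V \<le> dist x v" using vw(2) by (rule infdist_le)
  also have "\<dots> \<le> dist x y + dist y v" by (rule dist_triangle)
  also have "dist y v \<le> r" using vw by (simp add: dist_norm)
  finally show "infdist x V \<le> infdist x U + dK K U V + e" using y(2) r(1) by simp
qed

text \<open>A ball fixed in advance might miss \<open>P t\<close> altogether, and then
  \<open>dK\<close> says nothing about it. The test set is therefore adapted to each time, and the
  resulting local bounds are glued by bisection.\<close>

lemma abs_cont_setval_bounded:
  fixes P :: "real \<Rightarrow> 'a::real_normed_vector set"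
  assumes ac: "abs_cont_setval T P" and ne: "\<And>t. t \<in> {0..T} \<Longrightarrow> P t \<noteq> {}"
  obtains M where "\<And>t. t \<in> {0..T} \<Longrightarrow> infdist 0 (P t) \<le> M"
proof (cases "0 \<le> T")
  case True
  define Q where "Q a b \<longleftrightarrow> (\<exists>M. \<forall>t\<in>{a..b} \<inter> {0..T}. infdist 0 (P t) \<le> M)" for a b
  have "Q 0 T"
    using True
  proof (induction rule: Bolzano)
    case (trans a b c)
    then obtain M N where M: "\<forall>t\<in>{a..b} \<inter> {0..T}. infdist 0 (P t) \<le> M"
      and N: "\<forall>t\<in>{b..c} \<inter> {0..T}. infdist 0 (P t) \<le> N" unfolding Q_def by blast
    have "infdist 0 (P t) \<le> max M N" if "t \<in> {a..c} \<inter> {0..T}" for t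
      using bspec[OF M, of t] bspec[OF N, of t] that by (cases "t \<le> b") (auto simp: le_max_iff_disj)
    then show ?case unfolding Q_def by blast
  next
    case (local x)
    then have x: "x \<in> {0..T}" by simp
    then obtain y where y: "y \<in> P x" using ne by blast
    \<comment> \<open>A singleton test set suffices: it forces $P(t)$ to stay near $y$ for $t$ near $x$.\<close>
    have "compact {y}" by simp
    then obtain d where "d > 0" and d: "\<forall>n t s. disj_intervals 0 T n t s \<and> (\<Sum>i<n. s i - t i) < d
        \<longrightarrow> (\<Sum>i<n. dK {y} (P (s i)) (P (t i))) < 1"
      using ac[unfolded abs_cont_setval_def, rule_format, OF zero_less_one] by meson
    have "infdist 0 (P t) \<le> norm y + 1" if t: "t \<in> {0..T}" "\<bar>t - x\<bar> < d" for t
    proof -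
      have "dK {y} (P (max t x)) (P (min t x)) < 1"
        using d[rule_format, of "1" "\<lambda>_. min t x" "\<lambda>_. max t x"] t x
        by (auto simp: disj_intervals_def max_def min_def)
      then have "dK {y} (P x) (P t) < 1"
        by (cases "t \<le> x") (auto simp: dK_commute)
      then obtain r where r: "r < 1" "P x \<inter> {y} \<subseteq> {v + w |v w. v \<in> P t \<and> norm w \<le> r}"
        using dK_lessD[of "{y}" "P x" "P t" 1] ne[OF t(1)] ne[OF x] by auto
      then obtain v w where vw: "y = v + w" "v \<in> P t" "norm w \<le> r" using y by blast
      have "infdist 0 (P t) \<le> dist 0 v" using vw(2) by (rule infdist_le)
      also have "\<dots> \<le> norm y + norm w" using norm_triangle_ineq4[of y w] vw(1) by (simp add: algebra_simps)
      finally show ?thesis using vw(3) r(1) by simp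
    qed
    then have "Q a b" if "a \<le> x \<and> x \<le> b \<and> b - a < d" for a b
      using that unfolding Q_def by (intro exI[of _ "norm y + 1"]) auto
    then show ?case using \<open>d > 0\<close> by blast
  qed
  then obtain M where "\<forall>t\<in>{0..T} \<inter> {0..T}. infdist 0 (P t) \<le> M" unfolding Q_def by blast
  then show thesis by (intro that[of M]) simp
next
  case False
  then show thesis by (intro that[of 0]) auto
qed

text \<open>The increment splits into moving the point and moving the set. The intermediate term is
  the distance from \<open>z s\<close> to \<open>P t\<close> at different times, hence the bound
  \<open>R\<close> on nearest points for all pairs of times.\<close>

lemma abs_cont_on_infdist_tube:
  fixes z :: "real \<Rightarrow> 'a::euclidean_space"
  assumes P: "abs_cont_setval T P" "\<And>t. t \<in> {0..T} \<Longrightarrow> P t \<noteq> {} \<and> closed (P t)"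
    and z: "abs_cont_on a T z" and "0 \<le> a"
    and R: "\<And>s t y. \<lbrakk>s \<in> {a..T}; t \<in> {a..T}; y \<in> P t; dist (z s) y = infdist (z s) (P t)\<rbrakk> \<Longrightarrow> norm y \<le> R"
  shows "abs_cont_on a T (\<lambda>t. infdist (z t) (P t))"
  unfolding abs_cont_on_def
proof (intro allI impI)
  fix e :: real assume "e > 0"
  then have "e / 2 > 0" by simp
  let ?K = "cball (0::'a) R"
  obtain d where "d > 0" and d: "\<forall>n t s. disj_intervals a T n t s \<and> (\<Sum>i<n. s i - t i) < d
        \<longrightarrow> (\<Sum>i<n. norm (z (s i) - z (t i))) < e / 2"
    using z \<open>e / 2 > 0\<close> unfolding abs_cont_on_def by meson
  have "compact ?K" by simp
  then obtain d' where "d' > 0" and d': "\<forall>n t s. disj_intervals 0 T n t s \<and> (\<Sum>i<n. s i - t i) < d'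
        \<longrightarrow> (\<Sum>i<n. dK ?K (P (s i)) (P (t i))) < e / 2"
    using P(1)[unfolded abs_cont_setval_def, rule_format, OF \<open>e / 2 > 0\<close>] by meson
  have one: "infdist (z s) (P s) - infdist (z t) (P t) \<le> norm (z s - z t) + dK ?K (P s) (P t)"
    if "s \<in> {a..T}" "t \<in> {a..T}" for s t
  proof -
    have "infdist (z s) (P s) \<le> infdist (z s) (P t) + dK ?K (P t) (P s)"
      using that P(2)[of s] P(2)[of t] R \<open>0 \<le> a\<close> by (intro infdist_le_dK) auto
    also have "infdist (z s) (P t) \<le> infdist (z t) (P t) + dist (z s) (z t)"
      by (rule infdist_triangle)
    finally show ?thesis by (simp add: dist_norm dK_commute)
  qed
  have "(\<Sum>i<n. norm (infdist (z (s i)) (P (s i)) - infdist (z (t i)) (P (t i)))) < e"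
    if di: "disj_intervals a T n t s" "(\<Sum>i<n. s i - t i) < min d d'" for n t s
  proof -
    have mem: "t i \<in> {a..T}" "s i \<in> {a..T}" if "i < n" for i
      using di(1) that unfolding disj_intervals_def by fastforce+
    have "disj_intervals 0 T n t s"
      using di(1) \<open>0 \<le> a\<close> unfolding disj_intervals_def by (meson order_trans)
    then have "(\<Sum>i<n. dK ?K (P (s i)) (P (t i))) < e / 2" using d' di(2) by simp
    moreover have "(\<Sum>i<n. norm (z (s i) - z (t i))) < e / 2" using d di by simp
    moreover have "(\<Sum>i<n. norm (infdist (z (s i)) (P (s i)) - infdist (z (t i)) (P (t i))))
        \<le> (\<Sum>i<n. norm (z (s i) - z (t i)) + dK ?K (P (s i)) (P (t i)))"
    proof (rule sum_mono)
      fix i assume "i \<in> {..<n}"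
      then show "norm (infdist (z (s i)) (P (s i)) - infdist (z (t i)) (P (t i)))
          \<le> norm (z (s i) - z (t i)) + dK ?K (P (s i)) (P (t i))"
        using one[of "s i" "t i"] one[of "t i" "s i"] mem[of i]
        by (simp add: abs_le_iff norm_minus_commute dK_commute)
    qed
    ultimately show ?thesis by (simp add: sum.distrib)
  qed
  then show "\<exists>d>0. \<forall>n t s. disj_intervals a T n t s \<and> (\<Sum>i<n. s i - t i) < d \<longrightarrow>
      (\<Sum>i<n. norm (infdist (z (s i)) (P (s i)) - infdist (z (t i)) (P (t i)))) < e"
    using \<open>d > 0\<close> \<open>d' > 0\<close> by (intro exI[of _ "min d d'"]) auto
qed

text \<open>The ball factor and the last coordinate each contribute at most 1 to the squared norm.
  The rounded bound 2 becomes the factor in \<open>D \<le> 2 * k t * g t\<close>.\<close>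

lemma norm_cyl_le:
  assumes "b \<in> cyl"
  shows "norm b \<le> 2"
proof -
  have "(norm b)\<^sup>2 = (\<Sum>i\<in>UNIV. (b $ i)\<^sup>2)"
    unfolding power2_norm_eq_inner inner_vec_def by (simp add: power2_eq_square)
  also have "\<dots> = (b $ last_idx)\<^sup>2 + (\<Sum>i\<in>UNIV - {last_idx}. (b $ i)\<^sup>2)"
    by (simp add: sum.remove)
  also have "\<dots> \<le> 1 + 1"
    using assms by (intro add_mono) (auto simp: cyl_def abs_square_le_1)
  finally have "(norm b)\<^sup>2 \<le> 2\<^sup>2" by simp
  then show ?thesis by (rule power2_le_imp_le) simp
qed

section \<open>Invariance of the tube under the differential inclusion\<close>

theorem theorem4p16:
  fixes T :: real
    and E :: "real \<Rightarrow> real^'n::{finite,wellorder} \<Rightarrow> (real^'n::{finite,wellorder}) set"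
    and P :: "real \<Rightarrow> (real^'n::{finite,wellorder}) set"
    and C :: "real set"
    and t0 :: real and z0 :: "real^'n::{finite,wellorder}" and z :: "real \<Rightarrow> real^'n::{finite,wellorder}"
  assumes E1: "\<forall>t\<in>{0..T}. \<forall>x. E t x \<noteq> {} \<and> closed (E t x) \<and> convex (E t x)"
    and E2: "\<forall>t\<in>{0..T}. closed {(x, v). v \<in> E t x}"
    and E3: "\<forall>t\<in>{0..T}. lsc_setval (E t)"
    and E4: "\<forall>x. measurable_setval T (\<lambda>t. E t x)"
    and ELC: "\<forall>R>0. \<exists>k::real \<Rightarrow> real. k integrable_on {0..T} \<and> (\<forall>t\<in>{0..T}. k t \<ge> 0) \<and>
               (\<forall>t\<in>{0..T}. \<forall>x y. norm x \<le> R \<and> norm y \<le> R \<longrightarrow>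
                  E t x \<subseteq> {a + (k t * dist x y) *\<^sub>R b |a b. a \<in> E t y \<and> b \<in> cyl})"
    and P_ne: "\<forall>t\<in>{0..T}. P t \<noteq> {} \<and> closed (P t)"
    and P_ac: "abs_cont_setval T P"
    and C_sub: "C \<subseteq> {0<..<T}"
    and C_full: "{0<..<T} - C \<in> null_sets lebesgue"
    and tangency: "\<forall>t\<in>C. \<forall>x\<in>P t. \<forall>v\<in>E t x.
               (1, v) \<in> closure (convex hull (contingent_cone (gph T P) (t, x)))"
    and t0: "t0 \<in> {0<..<T}"
    and z0: "z0 \<in> P t0"
    and z_ac: "abs_cont_on t0 T z"
    and z_ode: "AE t in lebesgue. t \<in> {t0..T} \<longrightarrow>
               (\<exists>v. (z has_vector_derivative v) (at t) \<and> v \<in> E t (z t))"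
    and z_init: "z t0 = z0"
  shows "\<forall>t\<in>{t0..T}. z t \<in> P t"
proof (rule ccontr)
  define g where "g = (\<lambda>t. infdist (z t) (P t))"
  assume "\<not> (\<forall>t\<in>{t0..T}. z t \<in> P t)"
  then obtain t1 where t1: "t1 \<in> {t0..T}" "z t1 \<notin> P t1" by blast
  have T: "0 < t0" "t0 < T" using t0 by auto
  have P: "P t \<noteq> {}" "closed (P t)" if "t \<in> {0..T}" for t using P_ne that by auto
  have g_nonneg: "0 \<le> g t" for t by (simp add: g_def infdist_nonneg)
  have "g t1 > 0" using t1 T P[of t1] by (simp add: g_def infdist_pos_not_in_closed)
  have "g t0 = 0" using z0 z_init by (simp add: g_def)

  obtain M where M: "\<And>t. t \<in> {0..T} \<Longrightarrow> infdist 0 (P t) \<le> M"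
    using abs_cont_setval_bounded[OF P_ac] P(1) by blast
  have "bounded (z ` {t0..T})"
    by (intro compact_imp_bounded compact_continuous_image abs_cont_on_imp_continuous_on[OF z_ac]) simp
  then obtain B where "B > 0" and B: "\<And>t. t \<in> {t0..T} \<Longrightarrow> norm (z t) \<le> B"
    unfolding bounded_pos by auto
  \<comment> \<open>Two triangle inequalities bound nearest points by
    \<open>B + B + \<bar>M\<bar>\<close>. This \<open>R\<close> exceeds that, is positive and also
    bounds \<open>z\<close>, as the Lipschitz condition is applied to the pair \<open>z t\<close>
    and \<open>y\<close>.\<close>
  define R where "R = B + B + B + \<bar>M\<bar>"
  have R: "norm y \<le> R" if "s \<in> {t0..T}" "t \<in> {t0..T}" "dist (z s) y = infdist (z s) (P t)" for s t y
  proof -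
    have "norm y \<le> norm (z s) + dist (z s) y"
      using norm_triangle_sub[of y "z s"] by (simp add: dist_norm norm_minus_commute)
    also have "dist (z s) y \<le> infdist 0 (P t) + dist (z s) 0"
      using that(3) infdist_triangle by metis
    finally show ?thesis using B[OF that(1)] M[of t] that(2) T \<open>B > 0\<close> by (simp add: R_def)
  qed
  have "R > 0" using \<open>B > 0\<close> by (simp add: R_def)
  obtain k where k1: "k integrable_on {0..T}" and k2: "\<forall>t\<in>{0..T}. k t \<ge> 0"
    and Elip: "\<forall>t\<in>{0..T}. \<forall>x y. norm x \<le> R \<and> norm y \<le> R \<longrightarrow>
      E t x \<subseteq> {a + (k t * dist x y) *\<^sub>R b |a b. a \<in> E t y \<and> b \<in> cyl}"
    using ELC[rule_format, OF \<open>R > 0\<close>] by (elim exE conjE) (rule that)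
  note k = k1 k2[rule_format]

  have g_ac: "abs_cont_on t0 T g"
    unfolding g_def
    by (rule abs_cont_on_infdist_tube[OF P_ac _ z_ac, where R = R]) (use P R T in auto)
  have g_cont: "continuous_on {t0..T} g" by (rule abs_cont_on_imp_continuous_on[OF g_ac])

  obtain N0 where N0: "N0 \<in> null_sets lebesgue"
    "{t. \<not> (t \<in> {t0..T} \<longrightarrow> (\<exists>v. (z has_vector_derivative v) (at t) \<and> v \<in> E t (z t)))} \<subseteq> N0"
    using z_ode by (auto simp: eventually_ae_filter)
  \<comment> \<open>Times at which the inclusion, the tangency condition or differentiability of
    \<open>g\<close> may fail; the endpoints join because differentiability is known only inside the
    interval.\<close>
  define N where "N = N0 \<union> ({0<..<T} - C) \<union> {t \<in> {t0<..<T}. \<not> g differentiable (at t)} \<union> {t0, T}"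
  have "negligible N"
    unfolding N_def using N0(1) C_full abs_cont_on_differentiable_ae[OF g_ac]
    by (intro negligible_Un) (auto simp: negligible_iff_null_sets)

  have g_deriv: "\<exists>D. (g has_real_derivative D) (at t) \<and> D \<le> 2 * k t * g t"
    if t: "t \<in> {t0..T}" "t \<notin> N" "g t > 0" for t
  proof -
    have tN: "t \<notin> N0" "t \<in> C" "g differentiable (at t)" "t \<in> {0..T}"
      using t T unfolding N_def by auto
    obtain D where D: "(g has_real_derivative D) (at t)"
      using tN(3) unfolding real_differentiable_def by blast
    have "\<exists>v. (z has_vector_derivative v) (at t) \<and> v \<in> E t (z t)"
      using subsetD[OF N0(2), of t] tN(1) t(1) by auto
    then obtain v where v: "(z has_vector_derivative v) (at t)" "v \<in> E t (z t)" by blast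
    obtain y where y: "y \<in> P t" "infdist (z t) (P t) = dist (z t) y"
      using infdist_attains_inf[OF P(2)[OF tN(4)] P(1)[OF tN(4)]] by blast
    have "z t \<noteq> y" using t(3) y by (auto simp: g_def)
    have "norm (z t) \<le> R" using B[OF t(1)] \<open>B > 0\<close> by (simp add: R_def)
    moreover have "norm y \<le> R" using R[OF t(1) t(1)] y(2) by simp
    ultimately have "E t (z t) \<subseteq> {a + (k t * dist (z t) y) *\<^sub>R b |a b. a \<in> E t y \<and> b \<in> cyl}"
      using Elip tN(4) by simp
    then obtain a b where ab: "v = a + (k t * dist (z t) y) *\<^sub>R b" "a \<in> E t y" "b \<in> cyl"
      using v(2) by blast
    have "(1, a) \<in> closure (convex hull (contingent_cone (gph T P) (t, y)))"
      using tangency tN(2) y(1) ab(2) by blast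
    then have "D \<le> norm (v - a)"
      using infdist_tube_derivative_le[OF v(1) D[unfolded g_def] tN(4) y \<open>z t \<noteq> y\<close>] by simp
    also have "v - a = (k t * g t) *\<^sub>R b" using ab(1) y(2) by (simp add: g_def)
    also have "norm ((k t * g t) *\<^sub>R b) \<le> (k t * g t) * 2"
      using k(2)[OF tN(4)] g_nonneg[of t] norm_cyl_le[OF ab(3)]
      by (simp add: abs_mult mult_left_mono)
    finally show ?thesis using D by (intro exI[of _ D]) (simp add: mult_ac)
  qed

  \<comment> \<open>The last zero \<open>s\<close> of \<open>g\<close> before \<open>t1\<close>
    leaves \<open>g\<close> positive on the rest of the way, so that \<open>ln (g t)\<close> can be
    differentiated there.\<close>
  define Z where "Z = {t \<in> {t0..t1}. g t = 0}"
  have "closed Z"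
    unfolding Z_def using t1(1)
    by (intro continuous_closed_preimage_constant continuous_on_subset[OF g_cont]) auto
  moreover have "bounded Z" unfolding Z_def by (rule bounded_subset[of "{t0..t1}"]) auto
  ultimately have "compact Z" by (simp add: compact_eq_bounded_closed)
  moreover have "Z \<noteq> {}" using \<open>g t0 = 0\<close> t1(1) by (auto simp: Z_def)
  ultimately obtain s where s: "s \<in> Z" "\<And>t. t \<in> Z \<Longrightarrow> t \<le> s"
    using compact_attains_sup by metis
  have s': "t0 \<le> s" "s < t1" "g s = 0"
    using s(1) \<open>g t1 > 0\<close> by (auto simp: Z_def less_le)
  have g_pos: "g t > 0" if "s < t" "t \<le> t1" for t
    using s(2)[of t] that s' g_nonneg[of t] by (force simp: Z_def less_le)

  \<comment> \<open>This is the growth estimate read backwards from \<open>t1\<close>. It does not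
    depend on how close \<open>\<tau>\<close> is to \<open>s\<close>, so it contradicts continuity
    of \<open>g\<close> at its zero \<open>s\<close>.\<close>
  define m where "m = g t1 * exp (- (2 * integral {0..T} k))"
  have "m > 0" using \<open>g t1 > 0\<close> by (simp add: m_def)
  have g_ge: "m \<le> g \<tau>" if \<tau>: "s < \<tau>" "\<tau> \<le> t1" for \<tau>
  proof -
    have sub: "{\<tau>..t1} \<subseteq> {t0..T}" using \<tau> s' t1(1) by auto
    \<comment> \<open>The minimum over the compact interval supplies the positive lower bound that
      makes the logarithm Lipschitz; it may depend on \<open>\<tau>\<close>, unlike
      \<open>m\<close>.\<close>
    obtain q where q: "q \<in> {\<tau>..t1}" "\<And>t. t \<in> {\<tau>..t1} \<Longrightarrow> g q \<le> g t"
      using continuous_attains_inf[of "{\<tau>..t1}" g] continuous_on_subset[OF g_cont sub] \<tau> by auto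
    have ln_ac: "abs_cont_on \<tau> t1 (\<lambda>t. ln (g t))"
    proof (rule abs_cont_on_ln)
      show "abs_cont_on \<tau> t1 g"
        using \<tau> s' t1(1) by (intro abs_cont_on_subinterval[OF g_ac]) auto
      show "0 < g q" using g_pos q(1) \<tau> by auto
    qed (rule q(2))
    have k_int: "k integrable_on {\<tau>..t1}"
      using k(1) sub T by (intro integrable_on_subinterval[OF k(1)]) auto
    have "ln (g t1) - ln (g \<tau>) \<le> integral {\<tau>..t1} (\<lambda>t. 2 * k t)"
    proof (rule abs_cont_on_increment_le_integral[OF ln_ac \<tau>(2) _ \<open>negligible N\<close>])
      show "(\<lambda>t. 2 * k t) integrable_on {\<tau>..t1}" using k_int by (rule integrable_on_mult_right)
      fix t assume t: "t \<in> {\<tau>..t1} - N"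
      then have "g t > 0" using g_pos \<tau> by auto
      then obtain D where D: "(g has_real_derivative D) (at t)" "D \<le> 2 * k t * g t"
        using g_deriv[of t] t sub by auto
      have "((\<lambda>t. ln (g t)) has_real_derivative D / g t) (at t)"
        using D(1) \<open>g t > 0\<close> by (auto intro!: derivative_eq_intros)
      moreover have "D / g t \<le> 2 * k t" using D(2) \<open>g t > 0\<close> by (simp add: pos_divide_le_eq)
      ultimately show "\<exists>D. ((\<lambda>t. ln (g t)) has_real_derivative D) (at t) \<and> D \<le> 2 * k t" by blast
    qed
    also have "\<dots> = 2 * integral {\<tau>..t1} k" by simp
    \<comment> \<open>Nonnegativity of \<open>k\<close> allows the interval to be enlarged, which
      removes \<open>\<tau>\<close> from the bound.\<close>
    also have "integral {\<tau>..t1} k \<le> integral {0..T} k"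
      using k k_int sub T by (intro integral_subset_le) auto
    finally have "ln (g t1) - 2 * integral {0..T} k \<le> ln (g \<tau>)" by simp
    then have "exp (ln (g t1) - 2 * integral {0..T} k) \<le> exp (ln (g \<tau>))" by simp
    then show ?thesis
      using \<open>g t1 > 0\<close> g_pos[OF \<tau>] by (simp add: m_def exp_diff exp_minus field_simps)
  qed

  have "s \<in> {t0..T}" using s' t1(1) by auto
  then obtain d where "d > 0" and d: "\<And>t. \<lbrakk>t \<in> {t0..T}; dist t s < d\<rbrakk> \<Longrightarrow> dist (g t) (g s) < m"
    using g_cont \<open>m > 0\<close> unfolding continuous_on_iff by metis
  define t where "t = min t1 (s + d / 2)"
  have "s < t" "t \<le> t1" "dist t s < d" using s' \<open>d > 0\<close> by (auto simp: t_def dist_real_def)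
  then have "dist (g t) (g s) < m" using d[of t] s' t1(1) by auto
  with g_ge[OF \<open>s < t\<close> \<open>t \<le> t1\<close>] s'(3) show False by (simp add: dist_real_def)
qed

end
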